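(* Let $X$ and $Y$ be quantum measurements on a complex Hilbert space $\mathcal H$ of finite or countably infinite dimension. Then $X$ and $Y$ are jointly observable on (all) Schrödinger evolutions in $\mathcal H$ if and only if $X$ and $Y$ admit operator representations with respect to a common orthonormal basis of $\mathcal H$, i.e. there are an orthonormal basis $\{g_k\mid k\in N\}$ and real numbers $\lambda_k,\lambda'_k$ $(k\in N)$ such that $\sum_{k}\lambda_kP_{g_k}$ is an operator representation of $X$ and $\sum_k\lambda'_kP_{g_k}$ is an operator representation of $Y$.
   Context: Let $\mathcal H$ be a complex Hilbert space whose orthonormal bases are indexed by $N=\{1,\dots,n\}$ or $N=\mathbb N$. For a unit vector $e\in\mathcal H$, $P_e u=\langle u|e\rangle e$; for a unit vector $s$ (wave function) and a bounded operator $T$, $\tau_sT=\langle Ts|s\rangle$, so $\tau_sP_e=|\langle s|e\rangle|^2$. A quantum measurement $X$ is given by a bounded operator $M=\sum_{i\in N}\lambda_iP_{e_i}$ with $\{e_i\mid i\in N\}$ an orthonormal basis and $\lambda_i\in\mathbb R$. Let $\Lambda$ be its set of distinct eigenvalues. In the state given by a wave function $s$, $X$ takes the value $\lambda\in\Lambda$ with probability $\Pr_s\{X=\lambda\}=\sum_{i:\lambda_i=\lambda}\tau_sP_{e_i}$. An operator representation of $X$ (with respect to an orthonormal basis $\{g_k\}$) is a bounded operator $\sum_{k}\mu_kP_{g_k}$, $\mu_k\in\Lambda$, such that $\Pr_s\{X=\lambda\}=\sum_{k:\mu_k=\lambda}\tau_sP_{g_k}$ for every wave function $s$ and every $\lambda\in\Lambda$.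 A Schrödinger evolution is a sequence $s^{(t)}=U^ts$ $(t\ge0)$ with $U$ unitary on $\mathcal H$ and $s$ a wave function. Quantum measurements $X,Y$ with value sets $\Lambda,\Lambda'$ are jointly observable on the Schrödinger evolution $(s^{(t)})$ if there is a quantum measurement $Z$ with values in $\Lambda\times\Lambda'$, i.e. an orthonormal basis $\{g_k\mid k\in N\}$ of $\mathcal H$ and a map $\zeta:N\to\Lambda\times\Lambda'$ with $\Pr_{s^{(t)}}\{Z=(\lambda,\lambda')\}=\sum_{k\in\zeta^{-1}(\lambda,\lambda')}\tau_{s^{(t)}}P_{g_k}$, whose marginals are $X$ and $Y$: for all $t\ge0$, $\lambda\in\Lambda$, $\lambda'\in\Lambda'$, $\Pr_{s^{(t)}}\{X=\lambda\}=\sum_{\mu'\in\Lambda'}\Pr_{s^{(t)}}\{Z=(\lambda,\mu')\}$ and $\Pr_{s^{(t)}}\{Y=\lambda'\}=\sum_{\mu\in\Lambda}\Pr_{s^{(t)}}\{Z=(\mu,\lambda')\}$. They are jointly observable on Schrödinger evolutions if they are jointly observable on every Schrödinger evolution in $\mathcal H$. *)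

theory Defs
  imports "HOL-Analysis.Analysis"
begin

text \<open>
  Complex Hilbert spaces, with the inner product linear in its first argument. Completeness
  comes from the class \<open>banach\<close>, positive definiteness from the link with the norm.
\<close>

class complex_hilbert_space = banach +
  fixes scaleC :: "complex \<Rightarrow> 'a \<Rightarrow> 'a" (infixr "*\<^sub>C" 75)
    and cinner :: "'a \<Rightarrow> 'a \<Rightarrow> complex"
  assumes scaleC_add_right: "c *\<^sub>C (x + y) = c *\<^sub>C x + c *\<^sub>C y"
    and scaleC_add_left: "(c + d) *\<^sub>C x = c *\<^sub>C x + d *\<^sub>C x"
    and scaleC_scaleC: "c *\<^sub>C d *\<^sub>C x = (c * d) *\<^sub>C x"
    and scaleC_one: "1 *\<^sub>C x = x"
    and scaleR_scaleC: "r *\<^sub>R x = complex_of_real r *\<^sub>C x"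
    and cinner_commute: "cinner x y = cnj (cinner y x)"
    and cinner_add_left: "cinner (x + y) z = cinner x z + cinner y z"
    and cinner_scaleC_left: "cinner (c *\<^sub>C x) y = c * cinner x y"
    and cinner_self: "cinner x x = complex_of_real ((norm x)\<^sup>2)"

instantiation complex :: complex_hilbert_space
begin

definition scaleC_complex :: "complex \<Rightarrow> complex \<Rightarrow> complex"
  where "scaleC_complex c x = c * x"

definition cinner_complex :: "complex \<Rightarrow> complex \<Rightarrow> complex"
  where "cinner_complex x y = x * cnj y"

instance
  by standard
    (auto simp: scaleC_complex_def cinner_complex_def algebra_simps scaleR_conv_of_real
      complex_mult_cnj cmod_power2)

end

global_interpretation complex_vector: vector_space "scaleC :: complex \<Rightarrow> 'h \<Rightarrow> 'h::complex_hilbert_space"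
  by standard (simp_all add: scaleC_add_right scaleC_add_left scaleC_scaleC scaleC_one)

definition bounded_clinear :: "('h::complex_hilbert_space \<Rightarrow> 'h) \<Rightarrow> bool"
  where "bounded_clinear T \<longleftrightarrow> bounded_linear T \<and> (\<forall>c u. T (c *\<^sub>C u) = c *\<^sub>C T u)"

definition unitary :: "('h::complex_hilbert_space \<Rightarrow> 'h) \<Rightarrow> bool"
  where "unitary U \<longleftrightarrow> bounded_clinear U \<and> surj U \<and> (\<forall>u v. cinner (U u) (U v) = cinner u v)"

definition orthonormal_basis :: "nat set \<Rightarrow> (nat \<Rightarrow> 'h::complex_hilbert_space) \<Rightarrow> bool"
  where "orthonormal_basis N e \<longleftrightarrow>
    (\<forall>i\<in>N. \<forall>j\<in>N. cinner (e i) (e j) = (if i = j then 1 else 0)) \<and>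
    closure (complex_vector.span (e ` N)) = UNIV"

definition proj :: "'h::complex_hilbert_space \<Rightarrow> 'h \<Rightarrow> 'h"
  where "proj e u = cinner u e *\<^sub>C e"

definition wave_function :: "'h::complex_hilbert_space \<Rightarrow> bool"
  where "wave_function s \<longleftrightarrow> norm s = 1"

definition tau :: "'h::complex_hilbert_space \<Rightarrow> ('h \<Rightarrow> 'h) \<Rightarrow> complex"
  where "tau s T = cinner (T s) s"

lemma tau_proj: "tau s (proj e) = complex_of_real ((cmod (cinner s e))\<^sup>2)"
proof -
  have "tau s (proj e) = cinner s e * cnj (cinner s e)"
    by (simp add: tau_def proj_def cinner_scaleC_left cinner_commute[of e s])
  then show ?thesis by (simp only: complex_norm_square)
qed

text \<open>
  \<open>T\<close> is the bounded operator given by the sum of the \<open>\<mu> k *\<^sub>C proj (g k)\<close> over \<open>k \<in> N\<close>,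
  the series converging in the strong operator topology.
\<close>

definition diagonal_operator ::
  "nat set \<Rightarrow> (nat \<Rightarrow> 'h::complex_hilbert_space) \<Rightarrow> (nat \<Rightarrow> real) \<Rightarrow> ('h \<Rightarrow> 'h) \<Rightarrow> bool"
  where "diagonal_operator N g \<mu> T \<longleftrightarrow>
    orthonormal_basis N g \<and> bounded_clinear T \<and>
    (\<forall>u. ((\<lambda>k. complex_of_real (\<mu> k) *\<^sub>C proj (g k) u) has_sum T u) N)"

text \<open>
  Only real eigenvalues are collected; the operators of interest have no others
  (see \<open>diagonal_operator_eigenvalue\<close> below).
\<close>

definition eigenvalues :: "('h::complex_hilbert_space \<Rightarrow> 'h) \<Rightarrow> real set"
  where "eigenvalues T = {r. \<exists>u. u \<noteq> 0 \<and> T u = complex_of_real r *\<^sub>C u}"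

text \<open>
  The probability, in state \<open>s\<close>, of the outcome \<open>z\<close> when the basis vector \<open>g k\<close> is assigned the
  outcome \<open>\<zeta> k\<close>. By \<open>tau_proj\<close> the summands are nonnegative reals, so \<open>Re\<close> discards nothing, and
  the series converges for every orthonormal basis \<open>g\<close> by Bessel's inequality.
\<close>

definition outcome_prob ::
  "nat set \<Rightarrow> (nat \<Rightarrow> 'h::complex_hilbert_space) \<Rightarrow> (nat \<Rightarrow> 'v) \<Rightarrow> 'h \<Rightarrow> 'v \<Rightarrow> real"
  where "outcome_prob N g \<zeta> s z = (\<Sum>\<^sub>\<infinity>k\<in>{k\<in>N. \<zeta> k = z}. Re (tau s (proj (g k))))"

record 'h measurement =
  oper :: "'h \<Rightarrow> 'h"
  eigvec :: "nat \<Rightarrow> 'h"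
  eigval :: "nat \<Rightarrow> real"

definition quantum_measurement :: "nat set \<Rightarrow> 'h::complex_hilbert_space measurement \<Rightarrow> bool"
  where "quantum_measurement N X \<longleftrightarrow> diagonal_operator N (eigvec X) (eigval X) (oper X)"

definition value_set :: "'h::complex_hilbert_space measurement \<Rightarrow> real set"
  where "value_set X = eigenvalues (oper X)"

definition prob :: "nat set \<Rightarrow> 'h::complex_hilbert_space measurement \<Rightarrow> 'h \<Rightarrow> real \<Rightarrow> real"
  where "prob N X s r = outcome_prob N (eigvec X) (eigval X) s r"

definition operator_representation ::
  "nat set \<Rightarrow> 'h::complex_hilbert_space measurement \<Rightarrow> (nat \<Rightarrow> 'h) \<Rightarrow> (nat \<Rightarrow> real) \<Rightarrow> ('h \<Rightarrow> 'h) \<Rightarrow> bool"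
  where "operator_representation N X g \<mu> T \<longleftrightarrow>
    diagonal_operator N g \<mu> T \<and> (\<forall>k\<in>N. \<mu> k \<in> value_set X) \<and>
    (\<forall>s. wave_function s \<longrightarrow> (\<forall>r\<in>value_set X. prob N X s r = outcome_prob N g \<mu> s r))"

definition schroedinger_evolution :: "(nat \<Rightarrow> 'h::complex_hilbert_space) \<Rightarrow> bool"
  where "schroedinger_evolution \<sigma> \<longleftrightarrow>
    (\<exists>U s. unitary U \<and> wave_function s \<and> (\<forall>t. \<sigma> t = (U ^^ t) s))"

definition jointly_observable_on ::
  "nat set \<Rightarrow> 'h::complex_hilbert_space measurement \<Rightarrow> 'h measurement \<Rightarrow> (nat \<Rightarrow> 'h) \<Rightarrow> bool"
  where "jointly_observable_on N X Y \<sigma> \<longleftrightarrow>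
    (\<exists>g \<zeta>. orthonormal_basis N g \<and> \<zeta> \<in> N \<rightarrow> value_set X \<times> value_set Y \<and>
      (\<forall>t. \<forall>a\<in>value_set X. \<forall>b\<in>value_set Y.
        prob N X (\<sigma> t) a = (\<Sum>\<^sub>\<infinity>b'\<in>value_set Y. outcome_prob N g \<zeta> (\<sigma> t) (a, b')) \<and>
        prob N Y (\<sigma> t) b = (\<Sum>\<^sub>\<infinity>a'\<in>value_set X. outcome_prob N g \<zeta> (\<sigma> t) (a', b))))"

definition jointly_observable ::
  "nat set \<Rightarrow> 'h::complex_hilbert_space measurement \<Rightarrow> 'h measurement \<Rightarrow> bool"
  where "jointly_observable N X Y \<longleftrightarrow>
    (\<forall>\<sigma>. schroedinger_evolution \<sigma> \<longrightarrow> jointly_observable_on N X Y \<sigma>)"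

text \<open>The value set of a measurement consists of the coefficients of its operator.\<close>

lemma cinner_zero_left [simp]: "cinner 0 (v::'h::complex_hilbert_space) = 0"
  using cinner_add_left[of 0 0 v] by simp

lemma cinner_add_right: "cinner (u::'h::complex_hilbert_space) (v + w) = cinner u v + cinner u w"
  by (metis cinner_add_left cinner_commute complex_cnj_add)

lemma cinner_scaleC_right: "cinner (u::'h::complex_hilbert_space) (c *\<^sub>C v) = cnj c * cinner u v"
  by (metis cinner_commute cinner_scaleC_left complex_cnj_mult)

lemma Re_cinner: "Re (cinner (u::'h::complex_hilbert_space) v) = ((norm (u + v))\<^sup>2 - (norm u)\<^sup>2 - (norm v)\<^sup>2) / 2"
proof -
  have "complex_of_real ((norm (u + v))\<^sup>2) = cinner (u + v) (u + v)"
    by (simp only: cinner_self)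
  also have "\<dots> = cinner u u + cinner v v + (cinner u v + cnj (cinner u v))"
    by (simp add: cinner_add_left cinner_add_right cinner_commute[of v u])
  finally have "(norm (u + v))\<^sup>2 = Re (cinner u u + cinner v v + (cinner u v + cnj (cinner u v)))"
    by (metis Re_complex_of_real)
  then show ?thesis by (simp add: cinner_self)
qed

lemma continuous_cinner_right: "continuous_on UNIV (cinner (u::'h::complex_hilbert_space))"
proof -
  have Im: "Im (cinner u v) = - Re (cinner (\<i> *\<^sub>C u) v)" for v
    by (simp add: cinner_scaleC_left)
  have eq: "cinner u v = Complex (Re (cinner u v)) (- Re (cinner (\<i> *\<^sub>C u) v))" for v
    by (simp add: complex_eq_iff Im)
  have "continuous_on UNIV (\<lambda>v. Complex (Re (cinner u v)) (- Re (cinner (\<i> *\<^sub>C u) v)))"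
    unfolding Re_cinner Complex_eq by (intro continuous_intros) auto
  then show ?thesis
    by (subst (asm) eq[symmetric])
qed

lemma orthonormal_basis_total:
  assumes "orthonormal_basis N e" and "\<And>i. i \<in> N \<Longrightarrow> cinner u (e i) = 0"
  shows "u = (0::'h::complex_hilbert_space)"
proof -
  let ?S = "{v. cinner u v = 0}"
  have "complex_vector.subspace ?S"
    by (auto simp: complex_vector.subspace_def cinner_add_right cinner_scaleC_right cinner_commute[of u 0])
  then have "complex_vector.span (e ` N) \<subseteq> ?S"
    using assms(2) by (intro complex_vector.span_minimal) auto
  moreover have "closed ?S"
    using continuous_closed_preimage_constant[OF continuous_cinner_right closed_UNIV, of u 0] by simp
  ultimately have "closure (complex_vector.span (e ` N)) \<subseteq> ?S"
    by (rule closure_minimal)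
  then have "cinner u u = 0"
    using assms(1) by (auto simp: orthonormal_basis_def)
  then show ?thesis by (simp add: cinner_self)
qed

lemma diagonal_operator_coeff:
  assumes "diagonal_operator N g \<mu> T" and "i \<in> N"
  shows "cinner (T u) (g i) = complex_of_real (\<mu> i) * cinner u (g i)"
proof -
  have on: "cinner (g k) (g i) = (if k = i then 1 else 0)" if "k \<in> N" for k
    using assms that by (auto simp: diagonal_operator_def orthonormal_basis_def)
  let ?f = "\<lambda>k. complex_of_real (\<mu> k) *\<^sub>C proj (g k) u"
  have hs: "(?f has_sum T u) N"
    using assms by (simp add: diagonal_operator_def)
  have "((\<lambda>v. cinner v (g i)) \<circ> ?f has_sum cinner (T u) (g i)) N"
  proof (rule has_sum_comm_additive_general[OF _ _ hs])
    show "sum ((\<lambda>v. cinner v (g i)) \<circ> ?f) F = cinner (sum ?f F) (g i)" if "finite F" "F \<subseteq> N" for F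
      using that(1) by induction (simp_all add: cinner_add_left)
    have "isCont (cinner (g i)) (T u)"
      using continuous_cinner_right[of "g i"] by (simp add: continuous_on_eq_continuous_at)
    then have "((\<lambda>v. cnj (cinner (g i) v)) \<longlongrightarrow> cnj (cinner (g i) (T u))) (at (T u))"
      by (intro tendsto_cnj) (simp add: isCont_def)
    then show "(\<lambda>v. cinner v (g i)) \<midarrow>T u\<rightarrow> cinner (T u) (g i)"
      by (simp add: cinner_commute[symmetric])
  qed
  moreover have "((\<lambda>v. cinner v (g i)) \<circ> ?f has_sum complex_of_real (\<mu> i) * cinner u (g i)) N"
    by (rule has_sum_finite_neutralI[where B = "{i}"])
      (use assms(2) in \<open>auto simp: cinner_scaleC_left proj_def on\<close>)
  ultimately show ?thesis
    by (rule has_sum_unique)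
qed

lemma diagonal_operator_eigenvalue:
  assumes "diagonal_operator N g \<mu> T"
  shows "(\<exists>u. u \<noteq> 0 \<and> T u = c *\<^sub>C u) \<longleftrightarrow> (\<exists>i\<in>N. c = complex_of_real (\<mu> i))"
proof
  assume "\<exists>u. u \<noteq> 0 \<and> T u = c *\<^sub>C u"
  then obtain u where u: "u \<noteq> 0" "T u = c *\<^sub>C u" by blast
  then obtain i where i: "i \<in> N" "cinner u (g i) \<noteq> 0"
    using assms orthonormal_basis_total[of N g u] by (auto simp: diagonal_operator_def)
  from diagonal_operator_coeff[OF assms i(1), of u] show "\<exists>i\<in>N. c = complex_of_real (\<mu> i)"
    using i u by (auto simp: cinner_scaleC_left)
next
  assume "\<exists>i\<in>N. c = complex_of_real (\<mu> i)"
  then obtain i where i: "i \<in> N" "c = complex_of_real (\<mu> i)" by blast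
  have on: "cinner (g k) (g j) = (if k = j then 1 else 0)" if "k \<in> N" "j \<in> N" for k j
    using assms that by (auto simp: diagonal_operator_def orthonormal_basis_def)
  have "((\<lambda>k. complex_of_real (\<mu> k) *\<^sub>C proj (g k) (g i)) has_sum c *\<^sub>C g i) N"
    by (rule has_sum_finite_neutralI[where B = "{i}"])
      (use i on in \<open>auto simp: proj_def scaleC_one\<close>)
  then have "T (g i) = c *\<^sub>C g i"
    using assms has_sum_unique unfolding diagonal_operator_def by blast
  moreover have "g i \<noteq> 0"
    using on[OF i(1) i(1)] by auto
  ultimately show "\<exists>u. u \<noteq> 0 \<and> T u = c *\<^sub>C u" by blast
qed

corollary value_set_eq: "quantum_measurement N X \<Longrightarrow> value_set X = eigval X ` N"
  by (auto simp: quantum_measurement_def value_set_def eigenvalues_def diagonal_operator_eigenvalue)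

end

theory Submission
  imports Defs
begin

text \<open>
  If \<open>X\<close> and \<open>Y\<close> have representations in a common basis, pairing the coefficients gives \<open>Z\<close>.

  For the converse, one well chosen evolution suffices. Let \<open>U\<close> be diagonal in a basis \<open>e\<close> with
  eigenvalues \<open>exp (\<i> / 3\<^sup>j)\<close>; as the powers of \<open>1/3\<close> form a Sidon set, the ratios of
  two distinct eigenvalues determine the pair. Let \<open>P\<close> be a spectral projector of \<open>X\<close> and \<open>Q\<close> the
  projector of the corresponding marginal of \<open>Z\<close>. Their quadratic forms agree along the orbit of
  a state \<open>s\<close>, so (by averaging over time) their off-diagonal entries in the basis \<open>e\<close> agree when no
  coordinate of \<open>s\<close> vanishes. The diagonal is recovered from \<open>P\<^sup>2 = P\<close> and \<open>Q\<^sup>2 = Q\<close>, provided one row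
  of \<open>P\<close> in the basis \<open>e\<close> has no zero entry off the diagonal. By Baire's theorem a reflection of the
  eigenbasis of \<open>X\<close> achieves this for all nonscalar spectral projectors of \<open>X\<close> and \<open>Y\<close> at once.
  Hence \<open>P = Q\<close>, and the marginals of \<open>Z\<close> represent \<open>X\<close> and \<open>Y\<close> in every state.
\<close>

section \<open>Elementary geometry of complex Hilbert spaces\<close>

lemma cinner_zero_right [simp]: "cinner (u::'h::complex_hilbert_space) 0 = 0"
  by (metis cinner_commute cinner_zero_left complex_cnj_zero)

lemma scaleC_zero_left [simp]: "0 *\<^sub>C (u::'h::complex_hilbert_space) = 0"
  by (rule complex_vector.scale_zero_left)

lemma scaleC_zero_right [simp]: "c *\<^sub>C (0::'h::complex_hilbert_space) = 0"
  by (rule complex_vector.scale_zero_right)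

lemma cinner_minus_left: "cinner (- u) (v::'h::complex_hilbert_space) = - cinner u v"
  using cinner_add_left[of u "- u" v] by (simp add: eq_neg_iff_add_eq_0 add.commute)

lemma cinner_minus_right: "cinner (u::'h::complex_hilbert_space) (- v) = - cinner u v"
  by (metis cinner_commute cinner_minus_left complex_cnj_minus)

lemma cinner_diff_left: "cinner (u - v) (w::'h::complex_hilbert_space) = cinner u w - cinner v w"
  using cinner_add_left[of u "- v" w] by (simp add: cinner_minus_left)

lemma cinner_diff_right: "cinner (u::'h::complex_hilbert_space) (v - w) = cinner u v - cinner u w"
  using cinner_add_right[of u v "- w"] by (simp add: cinner_minus_right)

lemma cinner_sum_left: "cinner (\<Sum>i\<in>A. f i) (v::'h::complex_hilbert_space) = (\<Sum>i\<in>A. cinner (f i) v)"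
  by (induction A rule: infinite_finite_induct) (auto simp: cinner_add_left)

lemma cinner_sum_right: "cinner (v::'h::complex_hilbert_space) (\<Sum>i\<in>A. f i) = (\<Sum>i\<in>A. cinner v (f i))"
  by (induction A rule: infinite_finite_induct) (auto simp: cinner_add_right)

lemmas cinner_distribs =
  cinner_add_left cinner_add_right cinner_diff_left cinner_diff_right
  cinner_scaleC_left cinner_scaleC_right

lemma scaleC_diff_right: "c *\<^sub>C (u - v) = c *\<^sub>C u - c *\<^sub>C (v::'h::complex_hilbert_space)"
  by (rule complex_vector.scale_right_diff_distrib)

lemma norm_scaleC: "norm (c *\<^sub>C (u::'h::complex_hilbert_space)) = cmod c * norm u"
proof -
  have "complex_of_real ((norm (c *\<^sub>C u))\<^sup>2) = cinner (c *\<^sub>C u) (c *\<^sub>C u)"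
    by (simp only: cinner_self)
  also have "\<dots> = (c * cnj c) * cinner u u"
    by (simp add: cinner_distribs)
  also have "\<dots> = complex_of_real ((cmod c * norm u)\<^sup>2)"
    by (simp only: cinner_self complex_norm_square[symmetric] power_mult_distrib of_real_mult)
  finally have "(norm (c *\<^sub>C u))\<^sup>2 = (cmod c * norm u)\<^sup>2"
    by (simp only: of_real_eq_iff)
  then show ?thesis by (simp add: power2_eq_iff_nonneg)
qed

lemma cinner_mult_swap: "cinner u v * cinner v u = complex_of_real ((cmod (cinner u v))\<^sup>2)"
  for u :: "'h::complex_hilbert_space"
  by (simp only: cinner_commute[of v u] complex_norm_square)

text \<open>The index type is general so that a single normalised vector, indexed by
  \<open>()\<close>, also counts as a family. Totality is kept apart because Bessel's inequality and
  the convergence of series rest on orthonormality alone.\<close>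

definition orthonormal_on :: "'i set \<Rightarrow> ('i \<Rightarrow> 'h::complex_hilbert_space) \<Rightarrow> bool"
  where "orthonormal_on N g \<longleftrightarrow> (\<forall>i\<in>N. \<forall>j\<in>N. cinner (g i) (g j) = (if i = j then 1 else 0))"

lemma orthonormal_basis_on: "orthonormal_basis N g \<Longrightarrow> orthonormal_on N g"
  by (simp add: orthonormal_basis_def orthonormal_on_def)

lemma norm_sum_orthonormal:
  assumes "orthonormal_on N g" "finite F" "F \<subseteq> N"
  shows "(norm (\<Sum>k\<in>F. a k *\<^sub>C g k))\<^sup>2 = (\<Sum>k\<in>F. (cmod (a k))\<^sup>2)"
proof -
  have "complex_of_real ((norm (\<Sum>k\<in>F. a k *\<^sub>C g k))\<^sup>2)
      = (\<Sum>k\<in>F. \<Sum>j\<in>F. cnj (a k) * (a j * cinner (g j) (g k)))"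
    by (simp only: cinner_self[symmetric] cinner_sum_left cinner_sum_right cinner_distribs
        sum_distrib_left)
  also have "\<dots> = (\<Sum>k\<in>F. \<Sum>j\<in>F. if j = k then cnj (a k) * a k else 0)"
    using assms by (intro sum.cong refl) (auto simp: orthonormal_on_def subset_iff)
  also have "\<dots> = (\<Sum>k\<in>F. complex_of_real ((cmod (a k))\<^sup>2))"
    using assms(2) by (intro sum.cong refl) (simp add: complex_norm_square mult.commute flip: of_real_power)
  finally show ?thesis
    by (simp only: of_real_sum[symmetric] of_real_eq_iff)
qed

text \<open>The gap between the two sides is the squared norm of \<open>u - ?p\<close>, where
  \<open>?p\<close> is the orthogonal projection of \<open>u\<close> onto the span of the
  \<open>g k\<close> with \<open>k \<in> F\<close>.\<close>

lemma Bessel_finite: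
  assumes "orthonormal_on N g" "finite F" "F \<subseteq> N"
  shows "(\<Sum>k\<in>F. (cmod (cinner u (g k)))\<^sup>2) \<le> (norm u)\<^sup>2"
proof -
  let ?p = "\<Sum>k\<in>F. cinner u (g k) *\<^sub>C g k"
  let ?S = "\<Sum>k\<in>F. (cmod (cinner u (g k)))\<^sup>2"
  have p: "cinner ?p ?p = complex_of_real ?S"
    using norm_sum_orthonormal[OF assms, of "\<lambda>k. cinner u (g k)"] by (simp add: cinner_self)
  have pu: "cinner ?p u = complex_of_real ?S"
    by (simp add: cinner_sum_left cinner_scaleC_left cinner_mult_swap flip: of_real_power)
  then have up: "cinner u ?p = complex_of_real ?S"
    by (metis cinner_commute complex_cnj_complex_of_real)
  have "complex_of_real ((norm (u - ?p))\<^sup>2) = cinner (u - ?p) (u - ?p)"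
    by (simp only: cinner_self)
  also have "\<dots> = complex_of_real ((norm u)\<^sup>2 - ?S)"
    unfolding cinner_diff_left cinner_diff_right p pu up by (simp add: cinner_self)
  finally have "(norm (u - ?p))\<^sup>2 = (norm u)\<^sup>2 - ?S"
    by (simp only: of_real_eq_iff)
  then show ?thesis by (smt (verit) zero_le_power2)
qed

text \<open>Bessel's inequality for the one-element family consisting of \<open>v\<close>
  normalised.\<close>

lemma cinner_Cauchy_Schwarz: "cmod (cinner u v) \<le> norm u * norm (v::'h::complex_hilbert_space)"
proof (cases "v = 0")
  case False
  let ?e = "complex_of_real (1 / norm v) *\<^sub>C v"
  have "orthonormal_on {()} (\<lambda>_. ?e)"
    using False by (simp add: orthonormal_on_def cinner_self norm_scaleC norm_divide)
  from Bessel_finite[OF this, of "{()}" u]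
  have "(cmod (cinner u ?e))\<^sup>2 \<le> (norm u)\<^sup>2" by simp
  then have "cmod (cinner u ?e) \<le> norm u"
    by (rule power2_le_imp_le) simp
  then show ?thesis
    using False by (simp add: cinner_scaleC_right norm_mult norm_divide field_simps)
qed simp

lemma bounded_linear_cinner_left: "bounded_linear (\<lambda>u::'h::complex_hilbert_space. cinner u v)"
  by (rule bounded_linear_intro[where K = "norm v"])
    (auto simp: cinner_distribs scaleR_scaleC scaleC_complex_def cinner_Cauchy_Schwarz)

lemma bounded_bilinear_cinner: "bounded_bilinear (cinner :: 'h::complex_hilbert_space \<Rightarrow> _)"
proof
  show "\<exists>K. \<forall>a b::'h. norm (cinner a b) \<le> norm a * norm b * K"
    by (rule exI[of _ 1]) (simp add: cinner_Cauchy_Schwarz)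
qed (simp_all add: cinner_distribs scaleR_scaleC scaleC_complex_def)

section \<open>Orthonormal expansions\<close>

text \<open>The finite partial sums form a Cauchy net: by Pythagoras, the squared distance from the
  sum over \<open>F0\<close> to that over a larger set is a part of the tail of a convergent series
  of squares. Completeness of the space supplies the limit.\<close>

lemma Riesz_Fischer:
  fixes g :: "'i \<Rightarrow> 'h::complex_hilbert_space"
  assumes "orthonormal_on N g" and sq: "(\<lambda>k. (cmod (a k))\<^sup>2) summable_on N"
  shows "(\<lambda>k. a k *\<^sub>C g k) summable_on N"
proof -
  let ?f = "\<lambda>k. a k *\<^sub>C g k" and ?q = "\<lambda>k. (cmod (a k))\<^sup>2"
  have "\<exists>P. eventually P (finite_subsets_at_top N) \<and>
      (\<forall>F F'. P F \<and> P F' \<longrightarrow> dist (sum ?f F) (sum ?f F') < e)" if "e > 0" for e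
  proof -
    \<comment> \<open>The tail bounds squared distances, so the target \<open>e / 2\<close> enters
      squared. Two partial sums are later compared through the one over \<open>F0\<close>, which
      costs \<open>e / 2\<close> each.\<close>
    define d where "d = (e / 2)\<^sup>2"
    have "d > 0" using that by (simp add: d_def)
    have "((\<lambda>F. sum ?q F) \<longlongrightarrow> infsum ?q N) (finite_subsets_at_top N)"
      using has_sum_infsum[OF sq] by (simp add: has_sum_def)
    then have "\<forall>\<^sub>F F in finite_subsets_at_top N. dist (sum ?q F) (infsum ?q N) < d"
      using \<open>d > 0\<close> by (rule tendstoD)
    then obtain F0 where "finite F0 \<and> F0 \<subseteq> N \<and>
        (\<forall>F. finite F \<and> F0 \<subseteq> F \<and> F \<subseteq> N \<longrightarrow> dist (sum ?q F) (infsum ?q N) < d)"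
      unfolding eventually_finite_subsets_at_top by (elim exE)
    then have F0: "finite F0" "F0 \<subseteq> N"
      and close: "\<And>F. finite F \<Longrightarrow> F0 \<subseteq> F \<Longrightarrow> F \<subseteq> N \<Longrightarrow> dist (sum ?q F) (infsum ?q N) < d"
      by simp_all
    have half: "dist (sum ?f F) (sum ?f F0) < e / 2" if F: "finite F" "F0 \<subseteq> F" "F \<subseteq> N" for F
    proof -
      have "(dist (sum ?f F) (sum ?f F0))\<^sup>2 = (norm (sum ?f (F - F0)))\<^sup>2"
        using F by (simp add: dist_norm sum_diff)
      also have "\<dots> = sum ?q (F - F0)"
        using F by (intro norm_sum_orthonormal[OF assms(1)]) auto
      also have "\<dots> = sum ?q F - sum ?q F0"
        using F F0 by (simp add: sum_diff)
      also have "\<dots> \<le> infsum ?q N - sum ?q F0"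
        using finite_sum_le_infsum[OF sq F(1,3)] by simp
      also have "\<dots> < d"
        using close[of F0] F0 by (simp add: dist_real_def)
      finally show ?thesis
        unfolding d_def by (rule power_less_imp_less_base) (use \<open>e > 0\<close> in simp)
    qed
    show ?thesis
    proof (intro exI conjI allI impI)
      show "\<forall>\<^sub>F F in finite_subsets_at_top N. finite F \<and> F0 \<subseteq> F \<and> F \<subseteq> N"
        unfolding eventually_finite_subsets_at_top using F0 by blast
      fix F F' assume "(finite F \<and> F0 \<subseteq> F \<and> F \<subseteq> N) \<and> finite F' \<and> F0 \<subseteq> F' \<and> F' \<subseteq> N"
      then have "dist (sum ?f F) (sum ?f F0) < e / 2" "dist (sum ?f F') (sum ?f F0) < e / 2"
        using half by blast+
      then show "dist (sum ?f F) (sum ?f F') < e"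
        by (rule dist_triangle_half_l)
    qed
  qed
  then have "cauchy_filter (filtermap (sum ?f) (finite_subsets_at_top N))"
    by (simp add: cauchy_filter_metric_filtermap)
  moreover have "complete (UNIV :: 'h set)"
    by (meson Cauchy_convergent UNIV_I complete_def convergent_def)
  ultimately obtain L where "(sum ?f \<longlongrightarrow> L) (finite_subsets_at_top N)"
    using cauchy_filter_complete_converges[of "filtermap (sum ?f) (finite_subsets_at_top N)" UNIV]
    by (auto simp: filterlim_def filtermap_bot_iff)
  then show ?thesis
    unfolding summable_on_def has_sum_def by blast
qed

lemma summable_on_Bessel:
  assumes "orthonormal_on N g"
  shows "(\<lambda>k. (cmod (cinner u (g k)))\<^sup>2) summable_on N"
  by (rule nonneg_bdd_above_summable_on)
    (auto intro!: bdd_aboveI[of _ "(norm u)\<^sup>2"] Bessel_finite[OF assms])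

lemma has_sum_cinner_left:
  assumes "(f has_sum S) A"
  shows "((\<lambda>k. cinner (f k) v) has_sum cinner S (v::'h::complex_hilbert_space)) A"
  using has_sum_bounded_linear[OF bounded_linear_cinner_left assms] .

lemma cinner_orthonormal_sum:
  assumes "orthonormal_on N g" "((\<lambda>k. a k *\<^sub>C g k) has_sum u) N" "i \<in> N"
  shows "cinner u (g i) = a i"
proof -
  have "((\<lambda>k. cinner (a k *\<^sub>C g k) (g i)) has_sum cinner u (g i)) N"
    by (rule has_sum_cinner_left) fact
  moreover have "((\<lambda>k. cinner (a k *\<^sub>C g k) (g i)) has_sum a i) N"
    by (rule has_sum_finite_neutralI[where B = "{i}"])
      (use assms(1,3) in \<open>auto simp: cinner_scaleC_left orthonormal_on_def\<close>)
  ultimately show ?thesis by (rule has_sum_unique)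
qed

text \<open>The series converges by Bessel and Riesz-Fischer, and its sum has the same coefficients
  as \<open>u\<close>. Totality is assumed in coordinate form so that the expansion is available
  before density of the span is known.\<close>

lemma orthonormal_expansion:
  assumes "orthonormal_on N g"
    and total: "\<And>v. (\<And>i. i \<in> N \<Longrightarrow> cinner v (g i) = 0) \<Longrightarrow> v = 0"
  shows "((\<lambda>k. cinner u (g k) *\<^sub>C g k) has_sum u) N"
proof -
  have "(\<lambda>k. cinner u (g k) *\<^sub>C g k) summable_on N"
    by (intro Riesz_Fischer[OF assms(1)] summable_on_Bessel[OF assms(1)])
  then obtain w where w: "((\<lambda>k. cinner u (g k) *\<^sub>C g k) has_sum w) N"
    unfolding summable_on_def by blast
  have "cinner w (g i) = cinner u (g i)" if "i \<in> N" for i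
    by (rule cinner_orthonormal_sum[OF assms(1) w that])
  then have "w - u = 0"
    by (intro total) (simp add: cinner_diff_left)
  then show ?thesis using w by simp
qed

lemma orthonormal_basis_expansion:
  assumes "orthonormal_basis N g"
  shows "((\<lambda>k. cinner u (g k) *\<^sub>C g k) has_sum u) N"
  using orthonormal_expansion[OF orthonormal_basis_on[OF assms]] orthonormal_basis_total[OF assms]
  by blast

text \<open>Converse of \<open>orthonormal_basis_total\<close>: the partial sums of the expansion
  lie in the span and converge to the given vector.\<close>

lemma orthonormal_basisI:
  assumes "orthonormal_on N g"
    and "\<And>v. (\<And>i. i \<in> N \<Longrightarrow> cinner v (g i) = 0) \<Longrightarrow> v = 0"
  shows "orthonormal_basis N g"
proof -
  have "u \<in> closure (complex_vector.span (g ` N))" for u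
  proof -
    have "((\<lambda>F. \<Sum>k\<in>F. cinner u (g k) *\<^sub>C g k) \<longlongrightarrow> u) (finite_subsets_at_top N)"
      using orthonormal_expansion[OF assms] by (simp add: has_sum_def)
    moreover have "\<forall>\<^sub>F F in finite_subsets_at_top N.
        (\<Sum>k\<in>F. cinner u (g k) *\<^sub>C g k) \<in> closure (complex_vector.span (g ` N))"
      by (intro eventually_finite_subsets_at_top_weakI set_mp[OF closure_subset]
          complex_vector.span_sum complex_vector.span_scale complex_vector.span_base) auto
    ultimately show ?thesis
      by (intro Lim_in_closed_set[of _ _ "finite_subsets_at_top N"]) auto
  qed
  then show ?thesis
    using assms(1) by (auto simp: orthonormal_basis_def orthonormal_on_def)
qed

lemma orthonormal_basis_eqI:
  assumes "orthonormal_basis N g" "\<And>i. i \<in> N \<Longrightarrow> cinner u (g i) = cinner v (g i)"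
  shows "u = (v::'h::complex_hilbert_space)"
  using orthonormal_basis_total[OF assms(1), of "u - v"] assms(2) by (simp add: cinner_diff_left)

lemma Parseval_cinner:
  assumes "orthonormal_basis N g"
  shows "((\<lambda>k. cinner u (g k) * cinner (g k) v) has_sum cinner u v) N"
  using has_sum_cinner_left[OF orthonormal_basis_expansion[OF assms], of u v]
  by (simp add: cinner_scaleC_left)

lemma Parseval_norm:
  assumes "orthonormal_basis N g"
  shows "((\<lambda>k. (cmod (cinner u (g k)))\<^sup>2) has_sum (norm u)\<^sup>2) N"
proof -
  have "((\<lambda>k. complex_of_real ((cmod (cinner u (g k)))\<^sup>2)) has_sum complex_of_real ((norm u)\<^sup>2)) N"
    using Parseval_cinner[OF assms, of u u] by (simp only: cinner_mult_swap cinner_self)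
  from has_sum_Re[OF this] show ?thesis by simp
qed

section \<open>Diagonal operators\<close>

text \<open>Complex coefficients let one construction provide spectral projectors, representing
  operators and unitary evolutions. A divergent \<open>infsum\<close> would have the default value
  0; the bound on \<open>l\<close> in the context below excludes this.\<close>

definition diag_op :: "nat set \<Rightarrow> (nat \<Rightarrow> 'h::complex_hilbert_space) \<Rightarrow> (nat \<Rightarrow> complex) \<Rightarrow> 'h \<Rightarrow> 'h"
  where "diag_op N g l u = (\<Sum>\<^sub>\<infinity>k\<in>N. (l k * cinner u (g k)) *\<^sub>C g k)"

context
  fixes N :: "nat set" and g :: "nat \<Rightarrow> 'h::complex_hilbert_space" and l :: "nat \<Rightarrow> complex" and C :: real
  assumes basis: "orthonormal_basis N g" and bound: "\<And>k. k \<in> N \<Longrightarrow> cmod (l k) \<le> C"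
begin

lemma has_sum_diag_op: "((\<lambda>k. (l k * cinner u (g k)) *\<^sub>C g k) has_sum diag_op N g l u) N"
proof -
  have "(\<lambda>k. C\<^sup>2 * (cmod (cinner u (g k)))\<^sup>2) summable_on N"
    by (intro summable_on_cmult_right summable_on_Bessel orthonormal_basis_on basis)
  then have "(\<lambda>k. (cmod (l k * cinner u (g k)))\<^sup>2) summable_on N"
    by (rule summable_on_comparison_test)
      (auto simp: norm_mult power_mult_distrib intro!: mult_right_mono power_mono bound)
  then show ?thesis
    unfolding diag_op_def
    by (intro has_sum_infsum Riesz_Fischer orthonormal_basis_on basis)
qed

lemma diag_op_coeff: "i \<in> N \<Longrightarrow> cinner (diag_op N g l u) (g i) = l i * cinner u (g i)"
  by (rule cinner_orthonormal_sum[OF orthonormal_basis_on[OF basis] has_sum_diag_op])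

lemma diag_op_cinner:
  "((\<lambda>k. l k * (cinner u (g k) * cinner (g k) v)) has_sum cinner (diag_op N g l u) v) N"
  using has_sum_cinner_left[OF has_sum_diag_op] by (simp add: cinner_scaleC_left mult.assoc)

lemma norm_diag_op_le: "norm (diag_op N g l u) \<le> C * norm u"
proof (cases "N = {}")
  \<comment> \<open>An index is what shows \<open>C \<ge> 0\<close>; without any index the space is
    trivial and both sides vanish.\<close>
  case True
  then have "u = 0" using orthonormal_basis_total[OF basis, of u] by simp
  then show ?thesis by (simp add: diag_op_def)
next
  case False
  then obtain k where "k \<in> N" by blast
  from order_trans[OF norm_ge_zero bound[OF this]] have "C \<ge> 0" .
  have "(norm (diag_op N g l u))\<^sup>2 \<le> C\<^sup>2 * (norm u)\<^sup>2"
  proof (rule has_sum_mono)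
    show "((\<lambda>k. (cmod (cinner (diag_op N g l u) (g k)))\<^sup>2) has_sum (norm (diag_op N g l u))\<^sup>2) N"
      by (rule Parseval_norm[OF basis])
    show "((\<lambda>k. C\<^sup>2 * (cmod (cinner u (g k)))\<^sup>2) has_sum C\<^sup>2 * (norm u)\<^sup>2) N"
      by (intro has_sum_cmult_right Parseval_norm[OF basis])
  qed (auto simp: diag_op_coeff norm_mult power_mult_distrib intro!: mult_right_mono power_mono bound)
  then have "(norm (diag_op N g l u))\<^sup>2 \<le> (C * norm u)\<^sup>2"
    by (simp only: power_mult_distrib)
  then show ?thesis
    by (rule power2_le_imp_le) (simp add: \<open>C \<ge> 0\<close>)
qed

lemma diag_op_bounded_clinear: "bounded_clinear (diag_op N g l)"
proof -
  have add: "diag_op N g l (u + v) = diag_op N g l u + diag_op N g l v" for u v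
    by (rule orthonormal_basis_eqI[OF basis]) (simp add: diag_op_coeff cinner_add_left algebra_simps)
  have scale: "diag_op N g l (c *\<^sub>C u) = c *\<^sub>C diag_op N g l u" for c u
    by (rule orthonormal_basis_eqI[OF basis]) (simp add: diag_op_coeff cinner_scaleC_left)
  show ?thesis
    unfolding bounded_clinear_def
    by (auto simp: add scale scaleR_scaleC norm_diag_op_le mult.commute
        intro!: bounded_linear_intro[where K = C])
qed

end

lemma diagonal_operator_diag_op:
  assumes "orthonormal_basis N g" "\<And>k. k \<in> N \<Longrightarrow> \<bar>l k\<bar> \<le> C"
  shows "diagonal_operator N g l (diag_op N g (\<lambda>k. complex_of_real (l k)))"
  unfolding diagonal_operator_def proj_def scaleC_scaleC
  using assms has_sum_diag_op[OF assms(1), of "\<lambda>k. complex_of_real (l k)" C]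
    diag_op_bounded_clinear[OF assms(1), of "\<lambda>k. complex_of_real (l k)" C] by simp

text \<open>Parseval's series for the images agrees term by term with the original one, since
  \<open>l k * cnj (l k) = 1\<close>. The diagonal operator with conjugate coefficients is a right
  inverse, which gives surjectivity.\<close>

lemma diag_op_unitary:
  assumes basis: "orthonormal_basis N g" and l: "\<And>k. k \<in> N \<Longrightarrow> cmod (l k) = 1"
  shows "unitary (diag_op N g l)"
proof -
  have l1: "cmod (l k) \<le> 1" and l2: "cmod (cnj (l k)) \<le> 1" if "k \<in> N" for k
    using l that by simp_all
  have one: "l k * cnj (l k) = 1" if "k \<in> N" for k
    using l[OF that] complex_norm_square[of "l k"] by simp
  have inv: "diag_op N g l (diag_op N g (\<lambda>k. cnj (l k)) u) = u" for u
    by (rule orthonormal_basis_eqI[OF basis])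
      (simp add: diag_op_coeff[OF basis l1] diag_op_coeff[OF basis l2] one flip: mult.assoc)
  have iso: "cinner (diag_op N g l u) (diag_op N g l v) = cinner u v" for u v
  proof (rule has_sum_unique[OF Parseval_cinner[OF basis]])
    have eq: "cinner (diag_op N g l u) (g k) * cinner (g k) (diag_op N g l v)
        = cinner u (g k) * cinner (g k) v" if "k \<in> N" for k
    proof -
      have "cinner (g k) (diag_op N g l v) = cnj (l k) * cinner (g k) v"
        by (subst (1 2) cinner_commute) (simp add: diag_op_coeff[OF basis l1 that])
      then have "cinner (diag_op N g l u) (g k) * cinner (g k) (diag_op N g l v)
          = (l k * cnj (l k)) * (cinner u (g k) * cinner (g k) v)"
        using diag_op_coeff[OF basis l1 that, where u=u] by simp
      then show ?thesis using one[OF that] by simp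
    qed
    show "((\<lambda>k. cinner (diag_op N g l u) (g k) * cinner (g k) (diag_op N g l v)) has_sum cinner u v) N"
      by (subst has_sum_cong[OF eq]) (simp_all add: Parseval_cinner[OF basis])
  qed
  show ?thesis
    unfolding unitary_def
    by (intro conjI allI diag_op_bounded_clinear[OF basis l1] iso
        surjI[where g = "diag_op N g l", OF inv])
qed

definition is_projector :: "('h::complex_hilbert_space \<Rightarrow> 'h) \<Rightarrow> bool"
  where "is_projector P \<longleftrightarrow> bounded_clinear P \<and> (\<forall>u. P (P u) = P u) \<and> (\<forall>u v. cinner (P u) v = cinner u (P v))"

lemma diag_op_projector:
  assumes basis: "orthonormal_basis N g" and l: "\<And>k. l k = 0 \<or> l k = 1"
  shows "is_projector (diag_op N g l)"
proof -
  have l1: "cmod (l k) \<le> 1" for k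
    using l[of k] by auto
  have cnj: "cnj (l k) = l k" for k
    using l[of k] by auto
  have idem: "diag_op N g l (diag_op N g l u) = diag_op N g l u" for u
    by (rule orthonormal_basis_eqI[OF basis]) (use l in \<open>auto simp: diag_op_coeff[OF basis l1]\<close>)
  have adj: "cinner (diag_op N g l u) v = cinner u (diag_op N g l v)" for u v
  proof (rule has_sum_unique[OF diag_op_cinner[OF basis l1]])
    have "((\<lambda>k. cnj (l k * (cinner v (g k) * cinner (g k) u))) has_sum cnj (cinner (diag_op N g l v) u)) N"
      by (simp only: has_sum_cnj_iff diag_op_cinner[OF basis l1])
    then show "((\<lambda>k. l k * (cinner u (g k) * cinner (g k) v)) has_sum cinner u (diag_op N g l v)) N"
      by (simp add: cnj cinner_commute[symmetric] mult.commute)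
  qed
  show ?thesis
    unfolding is_projector_def
    by (intro conjI allI idem adj diag_op_bounded_clinear[OF basis l1])
qed

section \<open>Comparing two projectors in a basis\<close>

lemma bounded_clinearD:
  assumes "bounded_clinear T"
  shows "bounded_linear T" "T (u + v) = T u + T v" "T (u - v) = T u - T v" "T (c *\<^sub>C u) = c *\<^sub>C T u"
    "T (\<Sum>i\<in>A. f i) = (\<Sum>i\<in>A. T (f i))"
  using assms linear_add linear_diff linear_sum bounded_linear.linear
  unfolding bounded_clinear_def by blast+

lemma is_projectorD:
  assumes "is_projector P"
  shows "bounded_clinear P" "P (P u) = P u" "cinner (P u) v = cinner u (P v)"
  using assms by (simp_all add: is_projector_def)

lemma projector_cinner_self_real:
  assumes "is_projector P"
  shows "cnj (cinner (P u) u) = cinner (P u) u"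
  by (metis assms cinner_commute is_projectorD(3))

text \<open>
  Agreement off the diagonal makes \<open>P - Q\<close> diagonal, with entries \<open>d j\<close>. Comparing the
  \<open>(j, k)\<close> entries of \<open>Q\<^sup>2 = Q\<close> and \<open>P\<^sup>2 = P\<close> gives \<open>(d j + d k) * \<langle>P (e j), e k\<rangle> = 0\<close>, so \<open>d\<close> takes
  the value \<open>- d k\<^sub>0\<close> off \<open>k\<^sub>0\<close>, and the last two hypotheses force \<open>d k\<^sub>0 = 0\<close>.
\<close>

lemma projector_eqI:
  fixes P Q :: "'h::complex_hilbert_space \<Rightarrow> 'h"
  assumes P: "is_projector P" and Q: "is_projector Q"
    and basis: "orthonormal_basis N e" and k0: "k0 \<in> N"
    and nz: "\<And>j. j \<in> N \<Longrightarrow> j \<noteq> k0 \<Longrightarrow> cinner (P (e k0)) (e j) \<noteq> 0"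
    and off: "\<And>j k. j \<in> N \<Longrightarrow> k \<in> N \<Longrightarrow> j \<noteq> k \<Longrightarrow> cinner (P (e j)) (e k) = cinner (Q (e j)) (e k)"
    and s: "cinner (P s) s = cinner (Q s) s" "2 * (cmod (cinner s (e k0)))\<^sup>2 \<noteq> (norm s)\<^sup>2"
  shows "P = Q"
proof -
  define d where "d j = cinner (P (e j)) (e j) - cinner (Q (e j)) (e j)" for j
  have on: "cinner (e j) (e k) = (if j = k then 1 else 0)" if "j \<in> N" "k \<in> N" for j k
    using basis that by (simp add: orthonormal_basis_def)
  have cnj_d: "cnj (d j) = d j" for j
    by (simp add: d_def projector_cinner_self_real P Q)
  have diag: "Q (e j) = P (e j) - d j *\<^sub>C e j" if "j \<in> N" for j
    by (rule orthonormal_basis_eqI[OF basis])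
      (use off that in \<open>auto simp: cinner_distribs d_def on\<close>)
  have star: "d j = - d k0" if "j \<in> N" "j \<noteq> k0" for j
  proof -
    let ?p = "cinner (P (e k0)) (e j)"
    have PP: "cinner (P (e k0)) (P (e j)) = ?p"
      by (metis P is_projectorD(2,3))
    have P': "cinner (e k0) (P (e j)) = ?p"
      by (simp add: is_projectorD(3)[OF P])
    have "?p = cinner (Q (e k0)) (e j)"
      using off k0 that by blast
    also have "\<dots> = cinner (Q (e k0)) (Q (e j))"
      by (metis Q is_projectorD(2,3))
    also have "\<dots> = ?p - d j * ?p - d k0 * ?p"
      using that k0 by (simp add: diag cinner_distribs on PP P' cnj_d algebra_simps)
    finally have "(d j + d k0) * ?p = 0"
      by (simp add: algebra_simps)
    then show ?thesis
      using nz[OF that] by (simp add: add_eq_0_iff)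
  qed
  let ?D = "\<lambda>u. P u - Q u"
  have D: "cinner (?D u) (e j) = d j * cinner u (e j)" if "j \<in> N" for u j
  proof -
    have "cinner (?D u) (e j) = cinner u (P (e j) - Q (e j))"
      by (simp add: cinner_diff_left cinner_diff_right is_projectorD(3)[OF P] is_projectorD(3)[OF Q])
    also have "P (e j) - Q (e j) = d j *\<^sub>C e j"
      using diag[OF that] by simp
    finally show ?thesis by (simp add: cinner_scaleC_right cnj_d)
  qed
  \<comment> \<open>Thus \<open>?D\<close> is \<open>d k0\<close> times the reflection that fixes
    \<open>e k0\<close> and negates its orthogonal complement. Its quadratic form at
    \<open>s\<close> is \<open>d k0\<close> times a number that the last hypothesis keeps away from
    0.\<close>
  have Du: "?D u = (2 * d k0 * cinner u (e k0)) *\<^sub>C e k0 - d k0 *\<^sub>C u" for u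
  proof (rule orthonormal_basis_eqI[OF basis])
    fix i assume "i \<in> N"
    then show "cinner (?D u) (e i) = cinner ((2 * d k0 * cinner u (e k0)) *\<^sub>C e k0 - d k0 *\<^sub>C u) (e i)"
      using D[of i u] star[of i] k0 on[of k0 i] by (cases "i = k0") (simp_all add: cinner_distribs)
  qed
  have "0 = cinner (?D s) s"
    using s(1) by (simp add: cinner_diff_left)
  also have "\<dots> = d k0 * (2 * (cinner s (e k0) * cinner (e k0) s) - cinner s s)"
    unfolding Du by (simp add: cinner_distribs algebra_simps)
  also have "\<dots> = d k0 * complex_of_real (2 * (cmod (cinner s (e k0)))\<^sup>2 - (norm s)\<^sup>2)"
    by (simp only: cinner_mult_swap cinner_self of_real_diff of_real_mult of_real_numeral)
  finally have "d k0 * complex_of_real (2 * (cmod (cinner s (e k0)))\<^sup>2 - (norm s)\<^sup>2) = 0"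
    by (rule sym)
  moreover have "complex_of_real (2 * (cmod (cinner s (e k0)))\<^sup>2 - (norm s)\<^sup>2) \<noteq> 0"
    using s(2) by (simp only: of_real_eq_0_iff)
  ultimately have "d k0 = 0"
    using mult_eq_0_iff by blast
  then have "?D u = 0" for u
    using Du by simp
  then show ?thesis by auto
qed

section \<open>A basis in general position\<close>

text \<open>\<open>householder v\<close> is the reflection along \<open>v\<close> times \<open>(norm v)\<^sup>2\<close>, which makes it polynomial in \<open>v\<close>.\<close>

definition householder :: "'h::complex_hilbert_space \<Rightarrow> 'h \<Rightarrow> 'h"
  where "householder v u = cinner v v *\<^sub>C u - (2 * cinner u v) *\<^sub>C v"

lemma householder_cinner:
  "cinner (householder v u) (householder v w) = (cinner v v)\<^sup>2 * cinner u w"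
  for v :: "'h::complex_hilbert_space"
proof -
  have "cnj (cinner w v) = cinner v w" "cnj (cinner v v) = cinner v v"
    by (simp_all add: cinner_commute[symmetric])
  then show ?thesis
    unfolding householder_def by (simp add: cinner_distribs algebra_simps power2_eq_square)
qed

lemma householder_self_adjoint:
  "cinner (householder v u) w = cinner u (householder v w)" for v :: "'h::complex_hilbert_space"
proof -
  have "cnj (cinner w v) = cinner v w" "cnj (cinner v v) = cinner v v"
    by (simp_all add: cinner_commute[symmetric])
  then show ?thesis
    unfolding householder_def by (simp add: cinner_distribs)
qed

text \<open>After division by \<open>cinner v v\<close> the reflection is a self-adjoint isometry.
  Self-adjointness moves it onto the test vector, so totality follows from that of \<open>x\<close>
  and injectivity.\<close>

lemma householder_basis:
  fixes v :: "'h::complex_hilbert_space"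
  assumes "orthonormal_basis N x" "v \<noteq> 0"
  shows "orthonormal_basis N (\<lambda>j. (1 / cinner v v) *\<^sub>C householder v (x j))"
proof (rule orthonormal_basisI)
  have v: "cinner v v \<noteq> 0" "cnj (cinner v v) = cinner v v"
    using assms(2) by (simp_all add: cinner_self)
  then show "orthonormal_on N (\<lambda>j. (1 / cinner v v) *\<^sub>C householder v (x j))"
    using assms(1)
    by (auto simp: orthonormal_on_def orthonormal_basis_def cinner_distribs householder_cinner
        power2_eq_square)
  fix w assume "\<And>i. i \<in> N \<Longrightarrow> cinner w ((1 / cinner v v) *\<^sub>C householder v (x i)) = 0"
  then have "cinner (householder v w) (x i) = 0" if "i \<in> N" for i
    using that v by (simp add: cinner_distribs householder_self_adjoint)
  then have "householder v w = 0"
    by (rule orthonormal_basis_total[OF assms(1)])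
  then have "(cinner v v)\<^sup>2 * cinner w w = 0"
    by (metis cinner_zero_left householder_cinner)
  then show "w = 0"
    using v by (simp add: cinner_self)
qed

text \<open>Used in contrapositive form: if \<open>P\<close> is not scalar, some reflection makes
  its \<open>(x, y)\<close> entry nonzero. The vanishing entry is expanded into the identity
  \<open>F\<close>, and suitable choices of \<open>v\<close> kill the off-diagonal values of the
  form and equate the diagonal ones.\<close>

lemma projector_householder_entry_zero:
  fixes P :: "'h::complex_hilbert_space \<Rightarrow> 'h"
  assumes P: "is_projector P" and xy: "cinner x x = 1" "cinner y y = 1" "cinner x y = 0"
    and zero: "\<And>v. cinner (P (householder v x)) (householder v y) = 0"
  shows "\<exists>p. \<forall>w. cinner (P w) w = p * cinner w w"
proof -
  note lin = bounded_clinearD[OF is_projectorD(1)[OF P]]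
  have yx: "cinner y x = 0"
    using xy(3) by (metis cinner_commute complex_cnj_zero)
  let ?B = "\<lambda>u v. cinner (P u) v"
  have swap: "?B u v = cnj (?B v u)" for u v
    by (metis P cinner_commute is_projectorD(3))
  have F: "(cinner v v)\<^sup>2 * ?B x y - 2 * cinner v v * cinner v y * ?B x v
      - 2 * cinner v v * cinner x v * ?B v y + 4 * cinner x v * cinner v y * ?B v v = 0" for v
  proof -
    have "cnj (cinner y v) = cinner v y" "cnj (cinner v v) = cinner v v"
      by (simp_all add: cinner_commute[symmetric])
    then show ?thesis
      using zero[of v] unfolding householder_def
      by (simp add: lin cinner_distribs algebra_simps power2_eq_square)
  qed
  have Bxy: "?B x y = 0"
    using F[of x] by (simp add: xy)
  then have Byx: "?B y x = 0" using swap[of y x] by simp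
  have perp: "?B x u = 0 \<and> ?B u x = 0 \<and> ?B u y = 0 \<and> ?B y u = 0"
    if u: "cinner u x = 0" "cinner u y = 0" for u
  proof -
    have u': "cinner x u = 0" "cinner y u = 0"
      using u by (metis cinner_commute complex_cnj_zero)+
    have nz: "1 + cinner u u \<noteq> 0"
    proof -
      have "1 + cinner u u = complex_of_real (1 + (norm u)\<^sup>2)"
        by (simp add: cinner_self)
      moreover have "1 + (norm u)\<^sup>2 \<noteq> 0"
        by (smt (verit) zero_le_power2)
      ultimately show ?thesis by (simp only: of_real_eq_0_iff not_False_eq_True)
    qed
    have "2 + 2 * cinner u u = 2 * (1 + cinner u u)" by simp
    then have nz2: "2 + 2 * cinner u u \<noteq> 0"
      using nz by (simp only: mult_eq_0_iff) simp
    have "?B x u = 0"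
      using F[of "y + u"] nz nz2 by (simp add: lin cinner_distribs xy yx u u' Bxy)
    moreover have "?B u y = 0"
      using F[of "x + u"] nz nz2 by (simp add: lin cinner_distribs xy yx u u' Bxy)
    ultimately show ?thesis
      using swap[of u x] swap[of y u] by simp
  qed
  define p where "p = ?B x x"
  \<comment> \<open>The weights must differ: at \<open>x + y\<close> the identity \<open>F\<close>
    is trivial, whereas at \<open>2 *\<^sub>C x + y\<close> it becomes
    \<open>12 * (p - ?B y y) = 0\<close>.\<close>
  have Byy: "?B y y = p"
    using F[of "2 *\<^sub>C x + y"]
    by (simp add: lin cinner_distribs xy yx Bxy Byx p_def algebra_simps)
  have Buu: "?B u u = p * cinner u u" if u: "cinner u x = 0" "cinner u y = 0" for u
  proof -
    have u': "cinner x u = 0" "cinner y u = 0"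
      using u by (metis cinner_commute complex_cnj_zero)+
    show ?thesis
      using F[of "x + y + u"] perp[OF u] Byy p_def
      by (simp add: lin cinner_distribs xy yx u u' Bxy Byx algebra_simps)
  qed
  \<comment> \<open>Split \<open>w\<close> into its components along \<open>x\<close> and
    \<open>y\<close> and a remainder orthogonal to both; all cross terms of the form vanish.\<close>
  have "?B w w = p * cinner w w" for w
  proof -
    define a b where "a = cinner w x" and "b = cinner w y"
    define u where "u = w - a *\<^sub>C x - b *\<^sub>C y"
    have u: "cinner u x = 0" "cinner u y = 0"
      by (simp_all add: u_def a_def b_def cinner_distribs xy yx)
    have u': "cinner x u = 0" "cinner y u = 0"
      using u by (metis cinner_commute complex_cnj_zero)+
    have w: "w = a *\<^sub>C x + b *\<^sub>C y + u"
      by (simp add: u_def)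
    show ?thesis
      unfolding w using perp[OF u] Buu[OF u]
      by (simp add: lin cinner_distribs xy yx u u' Bxy Byx Byy p_def[symmetric] algebra_simps)
  qed
  then show ?thesis by blast
qed

section \<open>Polynomial behaviour along real lines\<close>

lemma poly_cinner_line:
  "\<exists>p :: complex poly. \<forall>t::real. cinner (a + complex_of_real t *\<^sub>C b) (c + complex_of_real t *\<^sub>C d)
      = poly p (complex_of_real t)" for a :: "'h::complex_hilbert_space"
  by (rule exI[of _ "[:cinner a c, cinner a d + cinner b c, cinner b d:]"])
    (simp add: cinner_distribs algebra_simps)

text \<open>Expanding both reflections leaves products of inner products that are polynomial along
  the line. The parameter is real, so the conjugation in the second argument does not affect
  it.\<close>

lemma poly_householder_entry_line:
  fixes P :: "'h::complex_hilbert_space \<Rightarrow> 'h"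
  assumes "bounded_clinear P"
  shows "\<exists>p :: complex poly. \<forall>t::real.
    cinner (P (householder (v + complex_of_real t *\<^sub>C w) x)) (householder (v + complex_of_real t *\<^sub>C w) y)
      = poly p (complex_of_real t)"
proof -
  note lin = bounded_clinearD[OF assms]
  let ?l = "\<lambda>t. v + complex_of_real t *\<^sub>C w"
  obtain q1 where q1: "\<And>t. cinner (?l t) (?l t) = poly q1 (complex_of_real t)"
    using poly_cinner_line[of v w v w] by blast
  obtain q2 where q2: "\<And>t. cinner (?l t) y = poly q2 (complex_of_real t)"
    using poly_cinner_line[of v w y 0] by auto
  obtain q3 where q3: "\<And>t. cinner x (?l t) = poly q3 (complex_of_real t)"
    using poly_cinner_line[of x 0 v w] by auto
  obtain q4 where q4: "\<And>t. cinner (P x) (?l t) = poly q4 (complex_of_real t)"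
    using poly_cinner_line[of "P x" 0 v w] by auto
  obtain q5 where q5: "\<And>t. cinner (P (?l t)) y = poly q5 (complex_of_real t)"
    using poly_cinner_line[of "P v" "P w" y 0] by (auto simp: lin)
  obtain q6 where q6: "\<And>t. cinner (P (?l t)) (?l t) = poly q6 (complex_of_real t)"
    using poly_cinner_line[of "P v" "P w" v w] by (auto simp: lin)
  have expand: "cinner (P (householder z x)) (householder z y)
      = cinner z z * cinner z z * cinner (P x) y - 2 * cinner z z * cinner z y * cinner (P x) z
      - 2 * cinner z z * cinner x z * cinner (P z) y + 4 * cinner x z * cinner z y * cinner (P z) z" for z
  proof -
    have "cnj (cinner y z) = cinner z y" "cnj (cinner z z) = cinner z z"
      by (simp_all add: cinner_commute[symmetric])
    then show ?thesis
      unfolding householder_def by (simp add: lin cinner_distribs algebra_simps)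
  qed
  show ?thesis
    by (rule exI[of _ "q1 * q1 * [:cinner (P x) y:] - 2 * q1 * q2 * q4 - 2 * q1 * q3 * q5 + 4 * q3 * q2 * q6"])
      (simp only: expand q1 q2 q3 q4 q5 q6, simp)
qed

text \<open>On the line from \<open>v\<close> to \<open>u\<close> the function is a polynomial that
  is nonzero at \<open>t = 1\<close>. It has finitely many roots, so points with nonzero value occur
  arbitrarily close to \<open>v\<close>.\<close>

lemma poly_line_nonzero_dense:
  fixes f :: "'h::complex_hilbert_space \<Rightarrow> complex"
  assumes poly: "\<And>v w. \<exists>p. \<forall>t::real. f (v + complex_of_real t *\<^sub>C w) = poly p (complex_of_real t)"
    and "f u \<noteq> 0"
  shows "closure {v. f v \<noteq> 0} = UNIV"
proof -
  have "\<exists>z\<in>{v. f v \<noteq> 0}. dist z v < e" if "e > 0" for v e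
  proof -
    obtain p where p: "\<And>t::real. f (v + complex_of_real t *\<^sub>C (u - v)) = poly p (complex_of_real t)"
      using poly by blast
    have "p \<noteq> 0"
      using p[of 1] assms(2) by (auto simp: scaleC_one)
    then have fin: "finite {t::real. poly p (complex_of_real t) = 0}"
      using finite_vimageI[OF poly_roots_finite, of p complex_of_real] by (simp add: vimage_def inj_def)
    \<comment> \<open>For \<open>t < r\<close> the point stays within \<open>e\<close> of
      \<open>v\<close>; the summand 1 keeps the denominator positive when
      \<open>u = v\<close>.\<close>
    define r where "r = e / (1 + norm (u - v))"
    have "r > 0" using that by (simp add: r_def add_pos_nonneg)
    then have "infinite {0<..<r}" by simp
    then have "infinite ({0<..<r} - {t::real. poly p (complex_of_real t) = 0})"
      using fin by (rule Diff_infinite_finite[rotated])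
    then have "{0<..<r} - {t::real. poly p (complex_of_real t) = 0} \<noteq> {}"
      by (metis finite.emptyI)
    then obtain t where "t \<in> {0<..<r} - {t. poly p (complex_of_real t) = 0}"
      by blast
    then have t: "0 < t" "t < r" "poly p (complex_of_real t) \<noteq> 0"
      by auto
    have "dist (v + complex_of_real t *\<^sub>C (u - v)) v = t * norm (u - v)"
      using t by (simp add: dist_norm norm_scaleC)
    also have "\<dots> \<le> t * (1 + norm (u - v))"
      using t by (intro mult_left_mono) auto
    also have "\<dots> < r * (1 + norm (u - v))"
      using t by (intro mult_strict_right_mono) (auto simp: add_pos_nonneg)
    also have "\<dots> = e"
      unfolding r_def by (smt (verit) nonzero_mult_div_cancel_right norm_ge_zero times_divide_eq_left)
    finally show ?thesis
      using t(3) p by (intro bexI[of _ "v + complex_of_real t *\<^sub>C (u - v)"]) auto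
  qed
  then show ?thesis
    by (auto simp: closure_approachable)
qed

section \<open>Baire category argument\<close>

lemma Baire_complete:
  fixes G :: "'a::complete_space set set"
  assumes "countable G" "\<And>T. T \<in> G \<Longrightarrow> open T \<and> closure T = UNIV"
  shows "closure (\<Inter>G) = UNIV"
proof -
  have "Met_TC.mcomplete TYPE('a)"
    by (simp add: complete_UNIV)
  from Met_TC.metric_Baire_category[OF this assms(1)] show ?thesis
    using assms(2) by simp
qed

lemma continuous_on_householder_entry:
  fixes P :: "'h::complex_hilbert_space \<Rightarrow> 'h"
  assumes "bounded_clinear P"
  shows "continuous_on UNIV (\<lambda>v. cinner (P (householder v x)) (householder v y))"
proof -
  note cont = bounded_bilinear.continuous_on[OF bounded_bilinear_cinner]
  have scale: "continuous_on UNIV (\<lambda>v. f v *\<^sub>C g v)" if "continuous_on UNIV f" "continuous_on UNIV g"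
    for f and g :: "'h \<Rightarrow> 'h"
  proof -
    have "bounded_bilinear (scaleC :: complex \<Rightarrow> 'h \<Rightarrow> 'h)"
    proof
      show "\<exists>K. \<forall>a b. norm (a *\<^sub>C (b::'h)) \<le> norm a * norm b * K"
        by (rule exI[of _ 1]) (simp add: norm_scaleC)
    qed (simp_all add: scaleC_add_left scaleC_add_right scaleR_scaleC scaleC_scaleC scaleC_complex_def mult.commute)
    from bounded_bilinear.continuous_on[OF this that] show ?thesis .
  qed
  have house: "continuous_on UNIV (\<lambda>v. householder v z)" for z :: 'h
    unfolding householder_def
    by (intro continuous_on_diff scale cont continuous_on_mult continuous_on_const continuous_on_id)
  show ?thesis
    by (intro cont house bounded_linear.continuous_on[OF bounded_clinearD(1)[OF assms]])
qed

text \<open>For each pair of a projector and an index, the reflection vectors giving a nonzero entry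
  form an open dense set. There are countably many pairs, so by Baire one vector serves them
  all.\<close>

lemma generic_basis:
  fixes x :: "nat \<Rightarrow> 'h::complex_hilbert_space" and \<P> :: "('h \<Rightarrow> 'h) set"
  assumes x: "orthonormal_basis N x" and k0: "k0 \<in> N" and "countable \<P>"
    and P: "\<And>P. P \<in> \<P> \<Longrightarrow> is_projector P"
    and nonscalar: "\<And>P p. P \<in> \<P> \<Longrightarrow> \<exists>w. cinner (P w) w \<noteq> p * cinner w w"
  obtains e where "orthonormal_basis N e"
    "\<And>P j. P \<in> \<P> \<Longrightarrow> j \<in> N \<Longrightarrow> j \<noteq> k0 \<Longrightarrow> cinner (P (e k0)) (e j) \<noteq> 0"
proof -
  define f where "f P j v = cinner (P (householder v (x k0))) (householder v (x j))" for P j v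
  define G where "G = (\<lambda>(P, j). {v. f P j v \<noteq> 0}) ` (\<P> \<times> (N - {k0}))"
  \<comment> \<open>Nonzero vectors are included as a further open dense set because the reflection
    has to be normalised.\<close>
  define G' where "G' = insert {v::'h. v \<noteq> 0} G"
  have on: "cinner (x i) (x j) = (if i = j then 1 else 0)" if "i \<in> N" "j \<in> N" for i j
    using x that by (simp add: orthonormal_basis_def)
  have xk0: "x k0 \<noteq> 0" using on[OF k0 k0] by auto
  have "closure (\<Inter>G') = UNIV"
  proof (rule Baire_complete)
    show "countable G'"
      using assms(3) by (simp add: G_def G'_def)
    fix T assume "T \<in> G'"
    then consider "T = {v::'h. v \<noteq> 0}" | P j where "P \<in> \<P>" "j \<in> N" "j \<noteq> k0" "T = {v. f P j v \<noteq> 0}"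
      by (auto simp: G_def G'_def)
    then show "open T \<and> closure T = UNIV"
    proof cases
      case 1
      \<comment> \<open>Density is shown for a smaller set, the complement of the kernel of a
        nonzero functional, to which the polynomial criterion applies.\<close>
      have "closure {v::'h. cinner v (x k0) \<noteq> 0} = UNIV"
      proof (rule poly_line_nonzero_dense)
        show "cinner (x k0) (x k0) \<noteq> 0" using on[OF k0 k0] by simp
        show "\<exists>p. \<forall>t. cinner (v + complex_of_real t *\<^sub>C w) (x k0) = poly p (complex_of_real t)" for v w
          using poly_cinner_line[of v w "x k0" 0] by auto
      qed
      moreover have "{v::'h. cinner v (x k0) \<noteq> 0} \<subseteq> {v. v \<noteq> 0}" by auto
      ultimately have "closure T = UNIV"
        using 1 closure_mono by (metis top.extremum_uniqueI)
      moreover have "open T"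
        unfolding 1 using open_Compl[of "{0::'h}"] by (simp add: Compl_eq)
      ultimately show ?thesis by simp
    next
      case 2
      note PP = P[OF 2(1)]
      have "\<exists>v. f P j v \<noteq> 0"
      proof (rule ccontr)
        assume "\<nexists>v. f P j v \<noteq> 0"
        then have "\<exists>p. \<forall>w. cinner (P w) w = p * cinner w w"
          using 2 k0 by (intro projector_householder_entry_zero[OF PP, of "x k0" "x j"]) (auto simp: f_def on)
        then show False using nonscalar[OF 2(1)] by metis
      qed
      then obtain v where "f P j v \<noteq> 0" ..
      then have "closure T = UNIV"
        unfolding 2(4)
        by (rule poly_line_nonzero_dense[rotated])
          (unfold f_def, rule poly_householder_entry_line[OF is_projectorD(1)[OF PP]])
      moreover have "open T"
        unfolding 2(4) f_def
        by (intro open_Collect_neq continuous_on_householder_entry is_projectorD(1)[OF PP] continuous_on_const)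
      ultimately show ?thesis by simp
    qed
  qed
  then have "\<Inter>G' \<noteq> {}" by (metis UNIV_not_empty closure_empty)
  then obtain v where v: "v \<noteq> 0" and nz: "\<And>P j. P \<in> \<P> \<Longrightarrow> j \<in> N \<Longrightarrow> j \<noteq> k0 \<Longrightarrow> f P j v \<noteq> 0"
    unfolding G_def G'_def by fastforce
  let ?e = "\<lambda>j. (1 / cinner v v) *\<^sub>C householder v (x j)"
  have "cinner (P (?e k0)) (?e j) \<noteq> 0" if "P \<in> \<P>" "j \<in> N" "j \<noteq> k0" for P j
    using nz[OF that] v bounded_clinearD(4)[OF is_projectorD(1)[OF P[OF that(1)]]]
    by (simp add: f_def cinner_distribs cinner_self)
  with householder_basis[OF x v] show thesis by (rule that)
qed

section \<open>Separating the matrix entries along an orbit\<close>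

text \<open>Multiplying by \<open>cnj (w p) ^ t\<close> and averaging over \<open>t < n\<close>
  isolates \<open>a p\<close>: every other frequency contributes a geometric sum bounded
  independently of \<open>n\<close>. A bound \<open>\<epsilon>\<close> instead of exact vanishing
  leaves room for a truncation error.\<close>

lemma unimodular_exponential_sum_bound:
  fixes a w :: "'i \<Rightarrow> complex"
  assumes "finite I" "p \<in> I" and w: "\<And>i. i \<in> I \<Longrightarrow> cmod (w i) = 1"
    and distinct: "\<And>i. i \<in> I \<Longrightarrow> i \<noteq> p \<Longrightarrow> w i \<noteq> w p"
    and bound: "\<And>t::nat. cmod (\<Sum>i\<in>I. a i * w i ^ t) \<le> \<epsilon>"
  shows "cmod (a p) \<le> \<epsilon>"
proof (rule ccontr)
  assume "\<not> ?thesis"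
  then have gap: "cmod (a p) - \<epsilon> > 0" by simp
  define r where "r i = w i * cnj (w p)" for i
  have wp: "w p * cnj (w p) = 1" "cmod (w p) = 1"
    using w[OF assms(2)] complex_norm_square[of "w p"] by simp_all
  have rp: "r p = 1" by (simp add: r_def wp)
  have r: "cmod (r i) = 1" if "i \<in> I" for i
    using w[OF that] wp by (simp add: r_def norm_mult)
  have r1: "r i \<noteq> 1" if "i \<in> I" "i \<noteq> p" for i
  proof
    assume "r i = 1"
    then have "w i * (cnj (w p) * w p) = w p"
      by (simp add: r_def flip: mult.assoc)
    then show False
      using distinct[OF that] wp by (simp add: mult.commute)
  qed
  \<comment> \<open>Each other term is controlled for all \<open>n\<close> by
    \<open>cmod (r i ^ n - 1) \<le> 2\<close> in the geometric sum formula.\<close>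
  define K where "K = (\<Sum>i\<in>I - {p}. cmod (a i) * (2 / cmod (r i - 1)))"
  have est: "real n * cmod (a p) \<le> real n * \<epsilon> + K" for n
  proof -
    have "(\<Sum>t<n. (\<Sum>i\<in>I. a i * w i ^ t) * cnj (w p) ^ t) = (\<Sum>t<n. \<Sum>i\<in>I. a i * r i ^ t)"
      by (intro sum.cong refl) (simp add: sum_distrib_right r_def power_mult_distrib mult.assoc)
    also have "\<dots> = (\<Sum>i\<in>I. a i * (\<Sum>t<n. r i ^ t))"
      by (subst sum.swap) (simp add: sum_distrib_left)
    also have "\<dots> = of_nat n * a p + (\<Sum>i\<in>I - {p}. a i * (\<Sum>t<n. r i ^ t))"
      by (subst sum.remove[OF assms(1,2)]) (simp add: rp)
    finally have split: "of_nat n * a p = (\<Sum>t<n. (\<Sum>i\<in>I. a i * w i ^ t) * cnj (w p) ^ t)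
        - (\<Sum>i\<in>I - {p}. a i * (\<Sum>t<n. r i ^ t))" by simp
    have "real n * cmod (a p) = cmod (of_nat n * a p)"
      by (simp add: norm_mult)
    also have "\<dots> \<le> cmod (\<Sum>t<n. (\<Sum>i\<in>I. a i * w i ^ t) * cnj (w p) ^ t)
        + cmod (\<Sum>i\<in>I - {p}. a i * (\<Sum>t<n. r i ^ t))"
      unfolding split by (rule norm_triangle_ineq4)
    finally have "real n * cmod (a p) \<le> cmod (\<Sum>t<n. (\<Sum>i\<in>I. a i * w i ^ t) * cnj (w p) ^ t)
        + cmod (\<Sum>i\<in>I - {p}. a i * (\<Sum>t<n. r i ^ t))" .
    moreover have "cmod (\<Sum>t<n. (\<Sum>i\<in>I. a i * w i ^ t) * cnj (w p) ^ t) \<le> real n * \<epsilon>"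
    proof -
      have "cmod (\<Sum>t<n. (\<Sum>i\<in>I. a i * w i ^ t) * cnj (w p) ^ t) \<le> (\<Sum>t<n. \<epsilon>)"
        by (rule sum_norm_le) (simp add: norm_mult norm_power wp bound)
      then show ?thesis by simp
    qed
    moreover have "cmod (\<Sum>i\<in>I - {p}. a i * (\<Sum>t<n. r i ^ t)) \<le> K"
      unfolding K_def
    proof (rule sum_norm_le)
      fix i assume i: "i \<in> I - {p}"
      have "cmod (r i ^ n - 1) \<le> 2"
        using norm_triangle_ineq4[of "r i ^ n" 1] r i by (simp add: norm_power)
      then have "cmod (\<Sum>t<n. r i ^ t) \<le> 2 / cmod (r i - 1)"
        using i r1 by (simp add: geometric_sum norm_divide divide_right_mono)
      then show "cmod (a i * (\<Sum>t<n. r i ^ t)) \<le> cmod (a i) * (2 / cmod (r i - 1))"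
        unfolding norm_mult by (rule mult_left_mono) simp
    qed
    ultimately show ?thesis by linarith
  qed
  obtain n where "K / (cmod (a p) - \<epsilon>) < real n"
    using reals_Archimedean2 by blast
  then have "K < real n * (cmod (a p) - \<epsilon>)"
    using gap by (simp add: pos_divide_less_eq)
  then show False
    using est[of n] by (simp add: algebra_simps)
qed

section \<open>Matrix entries from the orbit of a diagonal unitary\<close>

lemma norm_unitary_power:
  assumes "unitary U"
  shows "norm ((U ^^ t) u) = norm u"
proof (induction t)
  case (Suc t)
  have "complex_of_real ((norm (U v))\<^sup>2) = complex_of_real ((norm v)\<^sup>2)" for v
    using assms by (simp only: cinner_self[symmetric] unitary_def)
  then have "norm (U v) = norm v" for v
    by (simp only: of_real_eq_iff) (simp add: power2_eq_iff_nonneg)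
  then show ?case using Suc by simp
qed simp

lemma bounded_clinear_power:
  assumes "bounded_clinear U"
  shows "(U ^^ t) (u - v) = (U ^^ t) u - (U ^^ t) v"
  by (induction t) (simp_all add: bounded_clinearD[OF assms])

text \<open>Truncating \<open>s\<close> to finitely many coordinates turns the form along the orbit
  into a finite exponential sum with frequencies \<open>z k * cnj (z l)\<close>. By
  \<open>ratio\<close> the pair \<open>(i, j)\<close> has a frequency of its own; diagonal pairs all
  share the frequency 1, whence \<open>i \<noteq> j\<close>. The truncation error is uniform in time
  because the evolution is isometric.\<close>

lemma orbit_matrix_entry_zero:
  fixes e :: "nat \<Rightarrow> 'h::complex_hilbert_space"
  assumes basis: "orthonormal_basis N e" and z: "\<And>i. i \<in> N \<Longrightarrow> cmod (z i) = 1"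
    and ratio: "\<And>i j k l. \<lbrakk>i \<in> N; j \<in> N; k \<in> N; l \<in> N; i \<noteq> j; z k * cnj (z l) = z i * cnj (z j)\<rbrakk> \<Longrightarrow> k = i \<and> l = j"
    and D: "bounded_clinear D"
    and orbit: "\<And>t. cinner (D ((diag_op N e z ^^ t) s)) ((diag_op N e z ^^ t) s) = 0"
    and ij: "i \<in> N" "j \<in> N" "i \<noteq> j"
  shows "cinner s (e i) * cnj (cinner s (e j)) * cinner (D (e i)) (e j) = 0"
proof (rule ccontr)
  let ?U = "diag_op N e z"
  define c where "c k = cinner s (e k)" for k
  define a where "a = (\<lambda>(k, l). c k * cnj (c l) * cinner (D (e k)) (e l))"
  assume "\<not> ?thesis"
  then have pos: "cmod (a (i, j)) > 0" by (simp add: a_def c_def)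
  have z1: "cmod (z k) \<le> 1" if "k \<in> N" for k using z[OF that] by simp
  have unit: "unitary ?U" by (rule diag_op_unitary[OF basis z])
  have Ulin: "bounded_clinear ?U" using unit by (simp add: unitary_def)
  obtain K where K: "K > 0" "\<And>u. norm (D u) \<le> norm u * K"
    using bounded_linear.pos_bounded[OF bounded_clinearD(1)[OF D]] by blast
  \<comment> \<open>A Lipschitz constant for the quadratic form of \<open>D\<close> between the
    orbit of \<open>s\<close> and vectors within distance 1 of it: the two norms add up to at most
    \<open>2 * norm s + 1\<close>.\<close>
  define X where "X = K * (2 * norm s + 1)"
  have "X \<ge> 0" using K by (simp add: X_def)
  \<comment> \<open>The cap 1 keeps the truncated orbit within distance 1. The quotient with
    \<open>X + 1\<close> makes \<open>\<delta> * X\<close> strictly smaller than the coefficient at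
    \<open>(i, j)\<close>, which is the final contradiction.\<close>
  define \<delta> where "\<delta> = min 1 (cmod (a (i, j)) / (X + 1))"
  have \<delta>: "\<delta> > 0" "\<delta> \<le> 1" "\<delta> * (X + 1) \<le> cmod (a (i, j))"
  proof -
    show "\<delta> > 0" "\<delta> \<le> 1" using pos \<open>X \<ge> 0\<close> by (simp_all add: \<delta>_def)
    have "\<delta> \<le> cmod (a (i, j)) / (X + 1)" by (simp add: \<delta>_def)
    then show "\<delta> * (X + 1) \<le> cmod (a (i, j))"
      using \<open>X \<ge> 0\<close> by (simp add: pos_le_divide_eq)
  qed
  have "((\<lambda>F. \<Sum>k\<in>F. c k *\<^sub>C e k) \<longlongrightarrow> s) (finite_subsets_at_top N)"
    using orthonormal_basis_expansion[OF basis, of s] by (simp add: has_sum_def c_def)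
  from tendstoD[OF this \<delta>(1)]
  obtain F0 where F0: "finite F0 \<and> F0 \<subseteq> N \<and>
      (\<forall>F. finite F \<and> F0 \<subseteq> F \<and> F \<subseteq> N \<longrightarrow> dist (\<Sum>k\<in>F. c k *\<^sub>C e k) s < \<delta>)"
    unfolding eventually_finite_subsets_at_top by (elim exE)
  \<comment> \<open>Adjoining \<open>i\<close> and \<open>j\<close> ensures that the coefficient
    under study occurs in the finite sum.\<close>
  define F where "F = insert i (insert j F0)"
  have F: "finite F" "F \<subseteq> N" "i \<in> F" "j \<in> F" "F0 \<subseteq> F"
    using F0 ij by (simp_all add: F_def subset_insertI2)
  then have close: "dist (\<Sum>k\<in>F. c k *\<^sub>C e k) s < \<delta>"
    using F0 by simp
  define sF where "sF = (\<Sum>k\<in>F. c k *\<^sub>C e k)"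
  have Ue: "?U (e k) = z k *\<^sub>C e k" if "k \<in> N" for k
  proof (rule orthonormal_basis_eqI[OF basis])
    fix l assume "l \<in> N"
    then show "cinner (?U (e k)) (e l) = cinner (z k *\<^sub>C e k) (e l)"
      using basis that diag_op_coeff[OF basis z1, where i = l and u = "e k"]
      by (auto simp: cinner_scaleC_left orthonormal_basis_def)
  qed
  have UF: "(?U ^^ t) sF = (\<Sum>k\<in>F. (c k * z k ^ t) *\<^sub>C e k)" for t
  proof (induction t)
    case (Suc t)
    have "(?U ^^ Suc t) sF = (\<Sum>k\<in>F. (c k * z k ^ t) *\<^sub>C ?U (e k))"
      by (simp add: Suc bounded_clinearD[OF Ulin])
    also have "\<dots> = (\<Sum>k\<in>F. (c k * z k ^ Suc t) *\<^sub>C e k)"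
      using F(2) by (intro sum.cong refl) (auto simp: Ue scaleC_scaleC mult_ac)
    finally show ?case .
  qed (simp add: sF_def)
  have form: "cinner (D ((?U ^^ t) sF)) ((?U ^^ t) sF)
      = (\<Sum>m\<in>F \<times> F. a m * (z (fst m) * cnj (z (snd m))) ^ t)" for t
  proof -
    have "cinner (D ((?U ^^ t) sF)) ((?U ^^ t) sF)
        = (\<Sum>k\<in>F. \<Sum>l\<in>F. (c k * z k ^ t) * (cnj (c l * z l ^ t) * cinner (D (e k)) (e l)))"
      unfolding UF bounded_clinearD[OF D] cinner_sum_left cinner_scaleC_left cinner_sum_right
        cinner_scaleC_right sum_distrib_left
      by (subst sum.swap, intro sum.cong refl) (simp only: mult_ac)
    also have "\<dots> = (\<Sum>k\<in>F. \<Sum>l\<in>F. a (k, l) * (z k * cnj (z l)) ^ t)"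
      by (intro sum.cong refl) (simp add: a_def power_mult_distrib mult_ac)
    also have "\<dots> = (\<Sum>m\<in>F \<times> F. a m * (z (fst m) * cnj (z (snd m))) ^ t)"
      by (simp add: sum.cartesian_product case_prod_unfold)
    finally show ?thesis .
  qed
  have small: "cmod (cinner (D ((?U ^^ t) sF)) ((?U ^^ t) sF)) \<le> \<delta> * X" for t
  proof -
    define u v where "u = (?U ^^ t) s" and "v = (?U ^^ t) sF"
    have uv: "norm (u - v) \<le> \<delta>"
    proof -
      have "norm (u - v) = norm (s - sF)"
        by (simp add: u_def v_def bounded_clinear_power[OF Ulin, symmetric] norm_unitary_power[OF unit])
      then show ?thesis using close by (simp add: sF_def dist_norm norm_minus_commute)
    qed
    have u: "norm u = norm s" by (simp add: u_def norm_unitary_power[OF unit])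
    have v: "norm v \<le> norm s + 1"
      using norm_triangle_sub[of v u] uv \<delta>(2) by (simp add: u norm_minus_commute)
    have "cinner (D u) u = 0" using orbit[of t] by (simp add: u_def)
    then have "cinner (D v) v = - (cinner (D (u - v)) v + cinner (D u) (u - v))"
      by (simp add: bounded_clinearD[OF D] cinner_distribs)
    then have "cmod (cinner (D v) v) \<le> cmod (cinner (D (u - v)) v) + cmod (cinner (D u) (u - v))"
      using norm_triangle_ineq[of "cinner (D (u - v)) v" "cinner (D u) (u - v)"]
      by (simp only: norm_minus_cancel)
    also have "\<dots> \<le> norm (D (u - v)) * norm v + norm (D u) * norm (u - v)"
      by (intro add_mono cinner_Cauchy_Schwarz)
    also have "\<dots> \<le> (\<delta> * K) * (norm s + 1) + (norm s * K) * \<delta>"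
    proof (intro add_mono mult_mono)
      show "norm (D (u - v)) \<le> \<delta> * K"
        using K(2)[of "u - v"] mult_right_mono[OF uv, of K] K(1) by linarith
      show "norm (D u) \<le> norm s * K"
        using K(2)[of u] by (simp add: u)
    qed (use K(1) \<delta>(1) uv v in auto)
    also have "\<dots> = \<delta> * X" by (simp add: X_def algebra_simps)
    finally show ?thesis by (simp add: v_def)
  qed
  have "cmod (a (i, j)) \<le> \<delta> * X"
  proof (rule unimodular_exponential_sum_bound[where a = a
        and w = "\<lambda>m. z (fst m) * cnj (z (snd m))"])
    show "finite (F \<times> F)" "(i, j) \<in> F \<times> F" using F by auto
    show "cmod (z (fst m) * cnj (z (snd m))) = 1" if "m \<in> F \<times> F" for m
    proof -
      have "fst m \<in> N" "snd m \<in> N" using that F(2) by (simp_all add: mem_Times_iff subsetD)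
      then show ?thesis by (simp add: norm_mult z)
    qed
    show "z (fst m) * cnj (z (snd m)) \<noteq> z (fst (i, j)) * cnj (z (snd (i, j)))"
      if "m \<in> F \<times> F" "m \<noteq> (i, j)" for m
    proof -
      have "fst m \<in> N" "snd m \<in> N" using that(1) F(2) by (simp_all add: mem_Times_iff subsetD)
      from ratio[OF ij(1,2) this ij(3)] that(2) show ?thesis by (metis fst_conv snd_conv prod.collapse)
    qed
    show "cmod (\<Sum>m\<in>F \<times> F. a m * (z (fst m) * cnj (z (snd m))) ^ t) \<le> \<delta> * X" for t
      using small[of t] by (simp only: form)
  qed
  then show False
    using \<delta>(1,3) by (simp add: algebra_simps)
qed

section \<open>The Sidon property of the powers of 1/3\<close>

text \<open>If both exponents on the right exceeded \<open>i\<close>, the right side would be at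
  most 2/3 of \<open>(1/3) ^ i\<close>, less than the left side.\<close>

lemma powers_third_sum_eq_aux:
  assumes "(1/3::real) ^ i + (1/3) ^ l = (1/3) ^ k + (1/3) ^ j" "i \<le> k" "i \<le> j"
  shows "i = k \<or> i = j"
proof (rule ccontr)
  assume "\<not> ?thesis"
  then have "Suc i \<le> k" "Suc i \<le> j" using assms by auto
  then have "(1/3::real) ^ k \<le> (1/3) ^ Suc i" "(1/3::real) ^ j \<le> (1/3) ^ Suc i"
    by (intro power_decreasing; simp)+
  moreover have "(1/3::real) ^ i > 0" "(1/3::real) ^ l > 0" by simp_all
  ultimately show False using assms(1) by simp
qed

lemma powers_third_inj: "(1/3::real) ^ i = (1/3) ^ j \<Longrightarrow> i = j"
  by (subst (asm) power_inject_exp') auto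

text \<open>The smallest of the four exponents must recur on the other side. Cancelling this power
  leaves an equality of two single powers, and \<open>i \<noteq> j\<close> discards the crossed
  matchings.\<close>

lemma powers_third_Sidon:
  assumes "(1/3::real) ^ i + (1/3) ^ l = (1/3) ^ k + (1/3) ^ j" "i \<noteq> j"
  shows "k = i \<and> l = j"
proof -
  have "i = k \<or> i = j \<or> l = k \<or> l = j"
  proof -
    consider "i \<le> k" "i \<le> j" | "l \<le> k" "l \<le> j" | "k \<le> i" "k \<le> l" | "j \<le> i" "j \<le> l"
      by linarith
    then show ?thesis
    proof cases
      case 1 then show ?thesis using powers_third_sum_eq_aux[of i l k j] assms(1) by blast
    next
      case 2
      moreover have "(1/3::real) ^ l + (1/3) ^ i = (1/3) ^ k + (1/3) ^ j" using assms(1) by linarith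
      ultimately show ?thesis using powers_third_sum_eq_aux[of l i k j] by blast
    next
      case 3
      moreover have "(1/3::real) ^ k + (1/3) ^ j = (1/3) ^ i + (1/3) ^ l" using assms(1) by linarith
      ultimately show ?thesis using powers_third_sum_eq_aux[of k j i l] by blast
    next
      case 4
      moreover have "(1/3::real) ^ j + (1/3) ^ k = (1/3) ^ i + (1/3) ^ l" using assms(1) by linarith
      ultimately show ?thesis using powers_third_sum_eq_aux[of j k i l] by blast
    qed
  qed
  then show ?thesis
    using assms powers_third_inj by (elim disjE) auto
qed

text \<open>The angles are too small to wrap around the circle, so equal ratios mean equal angle
  differences and the Sidon property applies.\<close>

lemma cis_powers_third_ratio:
  assumes "cis ((1/3) ^ k) * cnj (cis ((1/3) ^ l)) = cis ((1/3) ^ i) * cnj (cis ((1/3) ^ j))" "i \<noteq> j"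
  shows "k = i \<and> l = j"
proof -
  define x where "x = ((1/3::real) ^ k - (1/3) ^ l) - ((1/3) ^ i - (1/3) ^ j)"
  have "cis ((1/3) ^ k - (1/3) ^ l) = cis ((1/3) ^ i - (1/3) ^ j)"
    using assms(1) by (simp add: cis_cnj cis_mult)
  then have "cis x = 1"
    by (simp add: x_def flip: cis_divide)
  then have "cos x = 1" by (simp add: complex_eq_iff)
  then obtain n :: int where n: "x = of_int n * (2 * pi)"
    using cos_one_2pi_int by auto
  have bnd: "0 < (1/3::real) ^ m" "(1/3::real) ^ m \<le> 1" for m
    by (simp_all add: power_le_one)
  \<comment> \<open>A crude bound from four numbers in the interval from 0 to 1, sufficient because
    \<open>2 * pi\<close> exceeds 6.\<close>
  have "\<bar>x\<bar> < 4"
    unfolding x_def using bnd[of i] bnd[of j] bnd[of k] bnd[of l] by linarith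
  moreover have "2 * pi > 4" using pi_gt3 by linarith
  moreover have "\<bar>x\<bar> = \<bar>real_of_int n\<bar> * (2 * pi)"
    by (simp add: n abs_mult)
  ultimately have "\<bar>real_of_int n\<bar> * (2 * pi) < 1 * (2 * pi)"
    by linarith
  then have "\<bar>real_of_int n\<bar> < 1"
    by (rule mult_right_less_imp_less) simp
  then have "x = 0" using n by simp
  then show ?thesis
    using assms(2) by (intro powers_third_Sidon) (simp_all add: x_def)
qed

section \<open>A state in general position\<close>

lemma generic_state:
  fixes e :: "nat \<Rightarrow> 'h::complex_hilbert_space"
  assumes basis: "orthonormal_basis N e" and k0: "k0 \<in> N"
  obtains s where "norm s = 1" "\<And>j. j \<in> N \<Longrightarrow> cinner s (e j) \<noteq> 0"
    "2 * (cmod (cinner s (e k0)))\<^sup>2 \<noteq> (norm s)\<^sup>2"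
proof -
  \<comment> \<open>Geometric decay gives nonzero, square summable coordinates. The coordinate at
    \<open>k0\<close> is left empty so that \<open>w\<close> is orthogonal to
    \<open>e k0\<close>.\<close>
  define a :: "nat \<Rightarrow> complex" where "a j = (if j = k0 then 0 else (1/3) ^ j)" for j
  have "summable (\<lambda>j::nat. (1/9::real) ^ j)" by simp
  then have "(\<lambda>j::nat. (1/9::real) ^ j) summable_on UNIV"
    by (rule summable_nonneg_imp_summable_on) simp
  then have "(\<lambda>j::nat. (1/9::real) ^ j) summable_on N"
    by (rule summable_on_subset_banach) simp
  then have "(\<lambda>j. (cmod (a j))\<^sup>2) summable_on N"
  proof (rule summable_on_comparison_test)
    show "(cmod (a j))\<^sup>2 \<le> (1/9) ^ j" for j
      by (simp add: a_def norm_power norm_divide power2_eq_square flip: power_mult_distrib)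
  qed simp
  then obtain w where w: "((\<lambda>j. a j *\<^sub>C e j) has_sum w) N"
    using Riesz_Fischer[OF orthonormal_basis_on[OF basis]] summable_on_def by blast
  note wc = cinner_orthonormal_sum[OF orthonormal_basis_on[OF basis] w]
  \<comment> \<open>Since \<open>r\<close> exceeds \<open>norm w\<close>, the coordinate at
    \<open>k0\<close> carries more than half of the squared norm, which yields the last
    requirement.\<close>
  define r where "r = 1 + norm w"
  define s where "s = w + complex_of_real r *\<^sub>C e k0"
  have "r > 0" by (simp add: r_def add_pos_nonneg)
  have on: "cinner (e i) (e j) = (if i = j then 1 else 0)" if "i \<in> N" "j \<in> N" for i j
    using basis that by (simp add: orthonormal_basis_def)
  have sc: "cinner s (e j) = (if j = k0 then complex_of_real r else (1/3) ^ j)" if "j \<in> N" for j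
    using wc[OF that] on[OF k0 that] by (auto simp: s_def cinner_distribs a_def)
  have "cinner (e k0) w = 0"
    using wc[OF k0] cinner_commute[of "e k0" w] by (simp add: a_def)
  then have "complex_of_real ((norm s)\<^sup>2) = complex_of_real ((norm w)\<^sup>2 + r\<^sup>2)"
    using wc[OF k0] on[OF k0 k0]
    by (simp only: cinner_self[symmetric] s_def cinner_distribs of_real_add)
      (simp add: a_def power2_eq_square)
  then have ns: "(norm s)\<^sup>2 = (norm w)\<^sup>2 + r\<^sup>2"
    by (simp only: of_real_eq_iff)
  then have "norm s \<noteq> 0" using \<open>r > 0\<close> by (smt (verit) zero_le_power2 zero_less_power power_zero_numeral)
  have lt: "(norm w)\<^sup>2 < r\<^sup>2"
    by (rule power_strict_mono) (simp_all add: r_def)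
  let ?s = "complex_of_real (1 / norm s) *\<^sub>C s"
  show thesis
  proof (rule that)
    show n1: "norm ?s = 1" using \<open>norm s \<noteq> 0\<close> by (simp add: norm_scaleC norm_divide)
    show "cinner ?s (e j) \<noteq> 0" if "j \<in> N" for j
      using \<open>norm s \<noteq> 0\<close> \<open>r > 0\<close> sc[OF that] by (simp add: cinner_scaleC_left)
    have "(cmod (cinner ?s (e k0)))\<^sup>2 = r\<^sup>2 / (norm s)\<^sup>2"
      using sc[OF k0] \<open>r > 0\<close> by (simp add: cinner_scaleC_left norm_mult norm_divide power_divide)
    then show "2 * (cmod (cinner ?s (e k0)))\<^sup>2 \<noteq> (norm ?s)\<^sup>2"
      unfolding n1 using ns lt \<open>norm s \<noteq> 0\<close> by (simp add: field_simps)
  qed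
qed

section \<open>Outcome probabilities\<close>

text \<open>The spectral projector of the outcome \<open>z\<close>; \<open>cinner_outcome_op\<close>
  identifies its quadratic form with the outcome probability.\<close>

definition outcome_op ::
  "nat set \<Rightarrow> (nat \<Rightarrow> 'h::complex_hilbert_space) \<Rightarrow> (nat \<Rightarrow> 'v) \<Rightarrow> 'v \<Rightarrow> 'h \<Rightarrow> 'h"
  where "outcome_op N g \<zeta> z = diag_op N g (\<lambda>k. if \<zeta> k = z then 1 else 0)"

lemma outcome_op_projector: "orthonormal_basis N g \<Longrightarrow> is_projector (outcome_op N g \<zeta> z)"
  unfolding outcome_op_def by (rule diag_op_projector) auto

lemma outcome_op_coeff:
  "orthonormal_basis N g \<Longrightarrow> i \<in> N \<Longrightarrow>
    cinner (outcome_op N g \<zeta> z u) (g i) = (if \<zeta> i = z then cinner u (g i) else 0)"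
  unfolding outcome_op_def by (subst diag_op_coeff[where C = 1]) auto

text \<open>Serves measurements with a single value, whose spectral projector is scalar and hence
  outside the reach of the generic basis.\<close>

lemma outcome_op_const:
  assumes "orthonormal_basis N g" "\<And>k. k \<in> N \<Longrightarrow> \<zeta> k = z"
  shows "outcome_op N g \<zeta> z = id"
proof
  fix u
  show "outcome_op N g \<zeta> z u = id u"
    by (rule orthonormal_basis_eqI[OF assms(1)]) (simp add: outcome_op_coeff assms)
qed

text \<open>Bessel's inequality guarantees that the \<open>infsum\<close> in
  \<open>outcome_prob\<close> is a genuine sum and not the default value 0.\<close>

lemma has_sum_outcome_prob:
  assumes "orthonormal_basis N g"
  shows "((\<lambda>k. (cmod (cinner s (g k)))\<^sup>2) has_sum outcome_prob N g \<zeta> s z) {k \<in> N. \<zeta> k = z}"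
proof -
  have "(\<lambda>k. (cmod (cinner s (g k)))\<^sup>2) summable_on {k \<in> N. \<zeta> k = z}"
    by (rule summable_on_subset_banach[OF summable_on_Bessel[OF orthonormal_basis_on[OF assms]]]) auto
  then show ?thesis
    unfolding outcome_prob_def tau_proj Re_complex_of_real by (rule has_sum_infsum)
qed

lemma cinner_outcome_op:
  assumes "orthonormal_basis N g"
  shows "cinner (outcome_op N g \<zeta> z s) s = complex_of_real (outcome_prob N g \<zeta> s z)"
proof (rule has_sum_unique)
  let ?l = "\<lambda>k. if \<zeta> k = z then 1 else (0::complex)"
  show "((\<lambda>k. ?l k * (cinner s (g k) * cinner (g k) s)) has_sum cinner (outcome_op N g \<zeta> z s) s) N"
    unfolding outcome_op_def by (rule diag_op_cinner[OF assms, where C = 1]) auto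
  have "((\<lambda>k. complex_of_real ((cmod (cinner s (g k)))\<^sup>2)) has_sum complex_of_real (outcome_prob N g \<zeta> s z))
      {k \<in> N. \<zeta> k = z}"
    by (rule has_sum_of_real[OF has_sum_outcome_prob[OF assms]])
  then show "((\<lambda>k. ?l k * (cinner s (g k) * cinner (g k) s))
      has_sum complex_of_real (outcome_prob N g \<zeta> s z)) N"
    by (subst (asm) has_sum_cong_neutral[where T = N and
          g = "\<lambda>k. ?l k * (cinner s (g k) * cinner (g k) s)"])
      (auto simp: cinner_mult_swap simp flip: of_real_power)
qed

section \<open>Marginals of a joint outcome map\<close>

lemma infsum_fibres:
  fixes f :: "'a \<Rightarrow> real"
  assumes "f summable_on S" "h ` S \<subseteq> B"
  shows "(\<Sum>\<^sub>\<infinity>b\<in>B. \<Sum>\<^sub>\<infinity>k\<in>{k\<in>S. h k = b}. f k) = (\<Sum>\<^sub>\<infinity>k\<in>S. f k)"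
proof -
  let ?T = "Sigma B (\<lambda>b. {k \<in> S. h k = b})"
  have bij: "bij_betw snd ?T S"
    using assms(2) by (intro bij_betwI[where g = "\<lambda>k. (h k, k)"]) auto
  have "(\<lambda>x. f (snd x)) summable_on ?T"
    using summable_on_reindex_bij_betw[OF bij, of f] assms(1) by simp
  then have "(\<lambda>(b, k). f k) summable_on ?T"
    by (simp add: case_prod_unfold)
  then have "(\<Sum>\<^sub>\<infinity>b\<in>B. \<Sum>\<^sub>\<infinity>k\<in>{k\<in>S. h k = b}. f k) = (\<Sum>\<^sub>\<infinity>(b, k)\<in>?T. f k)"
    by (rule infsum_Sigma'_banach)
  also have "\<dots> = (\<Sum>\<^sub>\<infinity>x\<in>?T. f (snd x))"
    by (simp add: case_prod_unfold)
  also have "\<dots> = (\<Sum>\<^sub>\<infinity>k\<in>S. f k)"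
    by (rule infsum_reindex_bij_betw[OF bij])
  finally show ?thesis .
qed

lemma infsum_outcome_prob_fibres:
  assumes "orthonormal_basis N g" "h ` N \<subseteq> B"
  shows "(\<Sum>\<^sub>\<infinity>b\<in>B. \<Sum>\<^sub>\<infinity>k\<in>{k\<in>{k\<in>N. \<zeta> k = a}. h k = b}. Re (tau s (proj (g k))))
    = outcome_prob N g \<zeta> s a"
  unfolding outcome_prob_def
  by (rule infsum_fibres)
    (use assms has_sum_imp_summable[OF has_sum_outcome_prob[OF assms(1), of s \<zeta> a]] in \<open>auto simp: tau_proj\<close>)

text \<open>Both sides sum over the same basis vectors, on the left grouped by the discarded
  component. The typing of \<open>\<zeta>\<close> ensures that the groups exhaust them, also for
  infinite value sets.\<close>

lemma outcome_prob_marginal: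
  assumes "orthonormal_basis N g" "\<zeta> \<in> N \<rightarrow> A \<times> B"
  shows "(\<Sum>\<^sub>\<infinity>b\<in>B. outcome_prob N g \<zeta> s (a, b)) = outcome_prob N g (\<lambda>k. fst (\<zeta> k)) s a"
    and "(\<Sum>\<^sub>\<infinity>a\<in>A. outcome_prob N g \<zeta> s (a, b)) = outcome_prob N g (\<lambda>k. snd (\<zeta> k)) s b"
proof -
  have 1: "{k \<in> N. \<zeta> k = (a, b)} = {k \<in> {k \<in> N. fst (\<zeta> k) = a}. snd (\<zeta> k) = b}"
    and 2: "{k \<in> N. \<zeta> k = (a, b)} = {k \<in> {k \<in> N. snd (\<zeta> k) = b}. fst (\<zeta> k) = a}" for a b
    by auto
  show "(\<Sum>\<^sub>\<infinity>b\<in>B. outcome_prob N g \<zeta> s (a, b)) = outcome_prob N g (\<lambda>k. fst (\<zeta> k)) s a"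
    unfolding outcome_prob_def[of N g \<zeta>] 1
    by (rule infsum_outcome_prob_fibres[OF assms(1)]) (use assms(2) in force)
  show "(\<Sum>\<^sub>\<infinity>a\<in>A. outcome_prob N g \<zeta> s (a, b)) = outcome_prob N g (\<lambda>k. snd (\<zeta> k)) s b"
    unfolding outcome_prob_def[of N g \<zeta>] 2
    by (rule infsum_outcome_prob_fibres[OF assms(1)]) (use assms(2) in force)
qed

text \<open>The form is 1 at the unit vector \<open>x i\<close> and 0 at the unit vector
  \<open>x j\<close>, so no single factor \<open>p\<close> fits both.\<close>

lemma outcome_op_nonscalar:
  assumes basis: "orthonormal_basis N x" and ij: "i \<in> N" "\<mu> i = a" "j \<in> N" "\<mu> j \<noteq> a"
  shows "\<exists>w. cinner (outcome_op N x \<mu> a w) w \<noteq> p * cinner w w"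
proof -
  have "cinner (x i) (x i) = 1" "cinner (x j) (x j) = 1"
    using basis ij by (simp_all add: orthonormal_basis_def)
  then have "cinner (outcome_op N x \<mu> a (x i)) (x i) = 1" "cinner (x i) (x i) = 1"
    "cinner (outcome_op N x \<mu> a (x j)) (x j) = 0" "cinner (x j) (x j) = 1"
    using basis ij by (simp_all add: outcome_op_coeff)
  then show ?thesis
    by (metis mult.right_neutral zero_neq_one)
qed

section \<open>Quantum measurements\<close>

lemma quantum_measurement_basis: "quantum_measurement N X \<Longrightarrow> orthonormal_basis N (eigvec X)"
  by (simp add: quantum_measurement_def diagonal_operator_def)

text \<open>Each value is the form of \<open>oper X\<close> at a unit eigenvector, hence at most the
  operator bound. This makes operators with coefficients in the value set bounded in any
  basis.\<close>

lemma value_set_bounded: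
  assumes X: "quantum_measurement N X"
  shows "\<exists>C. \<forall>r\<in>value_set X. \<bar>r\<bar> \<le> C"
proof -
  have diag: "diagonal_operator N (eigvec X) (eigval X) (oper X)"
    using X by (simp add: quantum_measurement_def)
  then have "bounded_linear (oper X)"
    by (simp add: diagonal_operator_def bounded_clinear_def)
  then obtain K where K: "\<And>u. norm (oper X u) \<le> norm u * K"
    using bounded_linear.bounded by blast
  have "\<bar>r\<bar> \<le> K" if r: "r \<in> value_set X" for r
  proof -
    obtain i where i: "i \<in> N" "r = eigval X i"
      using r unfolding value_set_eq[OF X] by blast
    have one: "cinner (eigvec X i) (eigvec X i) = 1"
      using quantum_measurement_basis[OF X] i by (simp add: orthonormal_basis_def)
    then have "(norm (eigvec X i))\<^sup>2 = 1"
      unfolding cinner_self by (simp only: of_real_eq_1_iff)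
    then have n: "norm (eigvec X i) = 1"
      by (simp add: power2_eq_1_iff) (smt (verit) norm_ge_zero)
    have "cmod (cinner (oper X (eigvec X i)) (eigvec X i)) = \<bar>r\<bar>"
      using diagonal_operator_coeff[OF diag i(1), of "eigvec X i"] one i by simp
    then show ?thesis
      using cinner_Cauchy_Schwarz[of "oper X (eigvec X i)" "eigvec X i"] K[of "eigvec X i"] n by simp
  qed
  then show ?thesis by blast
qed

text \<open>Probabilities are quadratic forms of outcome projectors, so equality of the projectors
  yields the required identity in every state.\<close>

lemma operator_representation_diag_op:
  assumes X: "quantum_measurement N X" and g: "orthonormal_basis N g"
    and l: "\<And>k. k \<in> N \<Longrightarrow> l k \<in> value_set X"
    and ops: "\<And>r. r \<in> value_set X \<Longrightarrow> outcome_op N (eigvec X) (eigval X) r = outcome_op N g l r"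
  shows "operator_representation N X g l (diag_op N g (\<lambda>k. complex_of_real (l k)))"
proof -
  obtain C where "\<forall>r\<in>value_set X. \<bar>r\<bar> \<le> C"
    using value_set_bounded[OF X] by blast
  then have "diagonal_operator N g l (diag_op N g (\<lambda>k. complex_of_real (l k)))"
    using l by (intro diagonal_operator_diag_op[OF g]) blast
  moreover have "prob N X s r = outcome_prob N g l s r" if "r \<in> value_set X" for s r
  proof -
    have "complex_of_real (prob N X s r) = complex_of_real (outcome_prob N g l s r)"
      unfolding prob_def cinner_outcome_op[OF quantum_measurement_basis[OF X], symmetric]
        cinner_outcome_op[OF g, symmetric] ops[OF that] by (rule refl)
    then show ?thesis by (simp only: of_real_eq_iff)
  qed
  ultimately show ?thesis
    using l by (simp add: operator_representation_def)
qed

lemma bounded_clinear_diff: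
  "bounded_clinear S \<Longrightarrow> bounded_clinear T \<Longrightarrow> bounded_clinear (\<lambda>u. S u - T u)"
  by (simp add: bounded_clinear_def bounded_linear_sub scaleC_diff_right)

text \<open>The only value of a one-valued measurement is left out: its projector is the identity,
  whose off-diagonal entries vanish in every basis.\<close>

definition nontrivial_spectral :: "nat set \<Rightarrow> 'h::complex_hilbert_space measurement \<Rightarrow> ('h \<Rightarrow> 'h) set"
  where "nontrivial_spectral N X =
    outcome_op N (eigvec X) (eigval X) ` {r \<in> value_set X. value_set X \<noteq> {r}}"

lemma nontrivial_spectral_nonscalar:
  assumes X: "quantum_measurement N X" and "P \<in> nontrivial_spectral N X"
  shows "is_projector P" "\<exists>w. cinner (P w) w \<noteq> p * cinner w w"
proof -
  obtain r where r: "r \<in> value_set X" "value_set X \<noteq> {r}" "P = outcome_op N (eigvec X) (eigval X) r"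
    using assms(2) by (auto simp: nontrivial_spectral_def)
  then obtain i j where "i \<in> N" "eigval X i = r" "j \<in> N" "eigval X j \<noteq> r"
    using value_set_eq[OF X] by auto
  then show "\<exists>w. cinner (P w) w \<noteq> p * cinner w w"
    unfolding r(3) by (rule outcome_op_nonscalar[OF quantum_measurement_basis[OF X]])
  show "is_projector P"
    unfolding r(3) by (rule outcome_op_projector[OF quantum_measurement_basis[OF X]])
qed

lemma countable_nontrivial_spectral:
  assumes "quantum_measurement N X"
  shows "countable (nontrivial_spectral N X)"
proof -
  have "countable (value_set X)"
    using value_set_eq[OF assms] by simp
  then show ?thesis
    unfolding nontrivial_spectral_def by (intro countable_image) (auto intro: countable_subset[rotated])
qed

text \<open>Passes from one orbit to all states. Equal probabilities along the orbit give equal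
  off-diagonal entries by \<open>orbit_matrix_entry_zero\<close> for the difference of the
  projectors; \<open>projector_eqI\<close> then recovers the diagonal.\<close>

lemma outcome_op_eq_if_orbit_eq:
  fixes X :: "'h::complex_hilbert_space measurement"
  defines "z \<equiv> \<lambda>j::nat. cis ((1/3) ^ j)"
  assumes X: "quantum_measurement N X" and g: "orthonormal_basis N g"
    and l: "\<And>k. k \<in> N \<Longrightarrow> l k \<in> value_set X" and r: "r \<in> value_set X"
    and e: "orthonormal_basis N e" and k0: "k0 \<in> N"
    and generic: "\<And>P j. P \<in> nontrivial_spectral N X \<Longrightarrow> j \<in> N \<Longrightarrow> j \<noteq> k0 \<Longrightarrow> cinner (P (e k0)) (e j) \<noteq> 0"
    and s: "\<And>j. j \<in> N \<Longrightarrow> cinner s (e j) \<noteq> 0" "2 * (cmod (cinner s (e k0)))\<^sup>2 \<noteq> (norm s)\<^sup>2"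
    and orbit: "\<And>t. prob N X ((diag_op N e z ^^ t) s) r = outcome_prob N g l ((diag_op N e z ^^ t) s) r"
  shows "outcome_op N (eigvec X) (eigval X) r = outcome_op N g l r"
proof (cases "value_set X = {r}")
  case True
  then have "outcome_op N (eigvec X) (eigval X) r = id" "outcome_op N g l r = id"
    using l value_set_eq[OF X] by (auto intro!: outcome_op_const quantum_measurement_basis[OF X] g)
  then show ?thesis by simp
next
  case False
  let ?P = "outcome_op N (eigvec X) (eigval X) r" and ?Q = "outcome_op N g l r"
  have PQ: "is_projector ?P" "is_projector ?Q"
    by (simp_all add: outcome_op_projector quantum_measurement_basis[OF X] g)
  have eq: "cinner (?P u) u = cinner (?Q u) u" if "u = (diag_op N e z ^^ t) s" for u t
    using orbit[of t] that
    by (simp add: cinner_outcome_op quantum_measurement_basis[OF X] g prob_def)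
  have off: "cinner (?P (e i)) (e j) = cinner (?Q (e i)) (e j)" if "i \<in> N" "j \<in> N" "i \<noteq> j" for i j
  proof -
    have "cinner s (e i) * cnj (cinner s (e j)) * cinner (?P (e i) - ?Q (e i)) (e j) = 0"
    proof (rule orbit_matrix_entry_zero[OF e _ _ _ _ that, where z = z and D = "\<lambda>u. ?P u - ?Q u"])
      show "cinner (?P ((diag_op N e z ^^ t) s) - ?Q ((diag_op N e z ^^ t) s)) ((diag_op N e z ^^ t) s) = 0" for t
        using eq[of _ t] by (simp add: cinner_diff_left)
    qed (use PQ in \<open>auto simp: z_def bounded_clinear_diff is_projectorD dest: cis_powers_third_ratio\<close>)
    then show ?thesis
      using s(1) that by (simp add: cinner_diff_left)
  qed
  show ?thesis
  proof (rule projector_eqI[OF PQ e k0 _ off _ s(2)])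
    show "cinner (?P (e k0)) (e j) \<noteq> 0" if "j \<in> N" "j \<noteq> k0" for j
      using generic that r False by (auto simp: nontrivial_spectral_def)
    \<comment> \<open>The orbit at time 0 is \<open>s\<close> itself.\<close>
    show "cinner (?P s) s = cinner (?Q s) s"
      using eq[of s 0] by simp
  qed
qed

section \<open>The two directions of the equivalence\<close>

lemma jointly_observable_common_basis:
  fixes X Y :: "'h::complex_hilbert_space measurement"
  assumes X: "quantum_measurement N X" and Y: "quantum_measurement N Y"
    and obs: "jointly_observable N X Y"
  obtains g l l' T T' where "orthonormal_basis N g"
    "operator_representation N X g l T" "operator_representation N Y g l' T'"
proof (cases "N = {}")
  \<comment> \<open>There is no \<open>k0\<close> to choose. The value sets are empty, so all
    conditions on values are vacuous and the eigenbasis of \<open>X\<close> serves for both.\<close>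
  case True
  note basis = quantum_measurement_basis[OF X]
  show thesis
    using True value_set_eq[OF X] value_set_eq[OF Y]
    by (intro that[OF basis operator_representation_diag_op[OF X basis, of "eigval X"]
          operator_representation_diag_op[OF Y basis, of "eigval Y"]]) auto
next
  case False
  then obtain k0 where k0: "k0 \<in> N" by blast
  \<comment> \<open>The joint measurement depends on the evolution, so a single basis and a single
    state have to be generic for \<open>X\<close> and \<open>Y\<close> simultaneously.\<close>
  let ?\<P> = "nontrivial_spectral N X \<union> nontrivial_spectral N Y"
  have "\<exists>w. cinner (P w) w \<noteq> p * cinner w w" "is_projector P" if "P \<in> ?\<P>" for P p
    using that nontrivial_spectral_nonscalar[OF X] nontrivial_spectral_nonscalar[OF Y] by blast+
  then obtain e where e: "orthonormal_basis N e"
    and generic: "\<And>P j. P \<in> ?\<P> \<Longrightarrow> j \<in> N \<Longrightarrow> j \<noteq> k0 \<Longrightarrow> cinner (P (e k0)) (e j) \<noteq> 0"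
    using generic_basis[OF quantum_measurement_basis[OF X] k0, of ?\<P>]
      countable_nontrivial_spectral[OF X] countable_nontrivial_spectral[OF Y] by (metis countable_Un)
  obtain s where s: "norm s = 1" "\<And>j. j \<in> N \<Longrightarrow> cinner s (e j) \<noteq> 0"
    "2 * (cmod (cinner s (e k0)))\<^sup>2 \<noteq> (norm s)\<^sup>2"
    using generic_state[OF e k0] by metis
  define U where "U = diag_op N e (\<lambda>j. cis ((1/3) ^ j))"
  define \<sigma> where "\<sigma> t = (U ^^ t) s" for t
  have "unitary U"
    unfolding U_def by (rule diag_op_unitary[OF e]) simp
  then have "schroedinger_evolution \<sigma>"
    unfolding schroedinger_evolution_def wave_function_def using s(1) \<sigma>_def by blast
  then obtain g \<zeta> where g: "orthonormal_basis N g" and \<zeta>: "\<zeta> \<in> N \<rightarrow> value_set X \<times> value_set Y"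
    and marg: "\<And>t a b. a \<in> value_set X \<Longrightarrow> b \<in> value_set Y \<Longrightarrow>
        prob N X (\<sigma> t) a = (\<Sum>\<^sub>\<infinity>b'\<in>value_set Y. outcome_prob N g \<zeta> (\<sigma> t) (a, b')) \<and>
        prob N Y (\<sigma> t) b = (\<Sum>\<^sub>\<infinity>a'\<in>value_set X. outcome_prob N g \<zeta> (\<sigma> t) (a', b))"
    using obs unfolding jointly_observable_def jointly_observable_on_def by blast
  \<comment> \<open>The two marginal identities are quantified jointly over \<open>a\<close> and
    \<open>b\<close>; extracting one of them takes some value of the other measurement.\<close>
  have ne: "value_set X \<noteq> {}" "value_set Y \<noteq> {}"
    using False value_set_eq[OF X] value_set_eq[OF Y] by auto
  have \<zeta>': "fst (\<zeta> k) \<in> value_set X" "snd (\<zeta> k) \<in> value_set Y" if "k \<in> N" for k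
    using \<zeta> that by (auto simp: Pi_iff mem_Times_iff)
  have opX: "outcome_op N (eigvec X) (eigval X) r = outcome_op N g (\<lambda>k. fst (\<zeta> k)) r"
    if "r \<in> value_set X" for r
  proof (rule outcome_op_eq_if_orbit_eq[OF X g \<zeta>'(1) that e k0 _ s(2,3)])
    show "prob N X ((diag_op N e (\<lambda>j. cis ((1/3) ^ j)) ^^ t) s) r
        = outcome_prob N g (\<lambda>k. fst (\<zeta> k)) ((diag_op N e (\<lambda>j. cis ((1/3) ^ j)) ^^ t) s) r" for t
      using marg[OF that, of _ t] ne(2) outcome_prob_marginal(1)[OF g \<zeta>]
      unfolding \<sigma>_def U_def by auto
  qed (use generic in auto)
  have opY: "outcome_op N (eigvec Y) (eigval Y) r = outcome_op N g (\<lambda>k. snd (\<zeta> k)) r"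
    if "r \<in> value_set Y" for r
  proof (rule outcome_op_eq_if_orbit_eq[OF Y g \<zeta>'(2) that e k0 _ s(2,3)])
    show "prob N Y ((diag_op N e (\<lambda>j. cis ((1/3) ^ j)) ^^ t) s) r
        = outcome_prob N g (\<lambda>k. snd (\<zeta> k)) ((diag_op N e (\<lambda>j. cis ((1/3) ^ j)) ^^ t) s) r" for t
      using marg[OF _ that, of _ t] ne(1) outcome_prob_marginal(2)[OF g \<zeta>]
      unfolding \<sigma>_def U_def by auto
  qed (use generic in auto)
  show thesis
    by (rule that[OF g operator_representation_diag_op[OF X g \<zeta>'(1) opX]
          operator_representation_diag_op[OF Y g \<zeta>'(2) opY]])
qed

lemma common_basis_jointly_observable:
  assumes g: "orthonormal_basis N g"
    and X: "operator_representation N X g l T" and Y: "operator_representation N Y g l' T'"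
  shows "jointly_observable N X Y"
  unfolding jointly_observable_def
proof (intro allI impI)
  fix \<sigma> :: "nat \<Rightarrow> 'a"
  assume "schroedinger_evolution \<sigma>"
  \<comment> \<open>Unitary powers preserve the norm, so the representation identities are available
    at every time.\<close>
  then have wave: "wave_function (\<sigma> t)" for t
    by (auto simp: schroedinger_evolution_def wave_function_def norm_unitary_power)
  let ?\<zeta> = "\<lambda>k. (l k, l' k)"
  have \<zeta>: "?\<zeta> \<in> N \<rightarrow> value_set X \<times> value_set Y"
    using X Y by (auto simp: operator_representation_def)
  have "prob N X (\<sigma> t) a = (\<Sum>\<^sub>\<infinity>b'\<in>value_set Y. outcome_prob N g ?\<zeta> (\<sigma> t) (a, b'))"
    if "a \<in> value_set X" for t a
    using X wave that by (simp add: operator_representation_def outcome_prob_marginal(1)[OF g \<zeta>])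
  moreover have "prob N Y (\<sigma> t) b = (\<Sum>\<^sub>\<infinity>a'\<in>value_set X. outcome_prob N g ?\<zeta> (\<sigma> t) (a', b))"
    if "b \<in> value_set Y" for t b
    using Y wave that by (simp add: operator_representation_def outcome_prob_marginal(2)[OF g \<zeta>])
  ultimately show "jointly_observable_on N X Y \<sigma>"
    unfolding jointly_observable_on_def using g \<zeta> by blast
qed

theorem theorem4:
  fixes N :: "nat set" and X Y :: "'h::complex_hilbert_space measurement"
  assumes "(\<exists>n. N = {1..n}) \<or> N = UNIV"
    and "quantum_measurement N X" and "quantum_measurement N Y"
  shows "jointly_observable N X Y \<longleftrightarrow>
    (\<exists>g l l'. orthonormal_basis N g \<and>
      (\<exists>T. operator_representation N X g l T) \<and> (\<exists>T'. operator_representation N Y g l' T'))"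
proof
  assume "jointly_observable N X Y"
  then show "\<exists>g l l'. orthonormal_basis N g \<and>
      (\<exists>T. operator_representation N X g l T) \<and> (\<exists>T'. operator_representation N Y g l' T')"
    using jointly_observable_common_basis[OF assms(2,3)] by metis
qed (use common_basis_jointly_observable in blast)

end
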